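(* For $x\in(0,1/2]$ let $$F_1(x)=[1+x(1-x)]\frac{R(x)}{B(x)},\quad F_2(x)=\frac{R(x)}{B(x)}-\frac{1}{1+x(1-x)},\quad F_3(x)=R(x)-\frac{B(x)}{1+x(1-x)}.$$ (1) There exists a unique number $x_1\in(1/4,1/2)$ such that $F_1$ is strictly increasing on $(0,x_1]$ and strictly decreasing on $[x_1,1/2]$, with $F_1(0^+)=1$ and $F_1(1/2)=(5\log2)/\pi=1.103178\cdots$. However, $F_1$ is neither convex nor concave on $(0,1/2]$. In particular, for $x\in(0,1/2]$, $$\frac{\alpha B(x)}{1+x(1-x)}<R(x)\leq\frac{\delta B(x)}{1+x(1-x)},$$ with the best possible coefficients $\alpha=1$ and $\delta=F_1(x_1)$. Moreover, $$1.111592\cdots=\frac{19\sqrt{2}\log8}{16\pi}<\delta<1.112146.$$ (2) There exists a unique number $x_2\in(0,1/2)$ such that $F_2$ is strictly increasing on $(0,x_2]$ and strictly decreasing on $[x_2,1/2]$, with $F_2(0^+)=0$ and $F_2(1/2)=4b_0/(5\pi)=0.082542\cdots$. However, $F_2$ is neither convex nor concave on $(0,1/2]$. (3) $F_3$ is strictly decreasing and convex from $(0,1/2]$ onto $[\rho,1)$, where $\rho=4b_0/5=\log16-4\pi/5=0.259314\cdots$. In particular, for $x\in(0,1/2]$, $$\rho+\frac{B(x)}{1+x(1-x)}\leq R(x)\leq\rho+(1-\rho)(1-2x)+\frac{B(x)}{1+x(1-x)},$$ with equality in each instance if and only if $x=1/2$.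
   Context: Let $\psi=\Gamma'/\Gamma$ be the digamma function and $\gamma$ the Euler–Mascheroni constant. For $x\in(0,1)$ put $$R(x)=-2\gamma-\psi(x)-\psi(1-x),\qquad B(x)=\Gamma(x)\Gamma(1-x)=\frac{\pi}{\sin(\pi x)}.$$ $b_0=5\log2-\pi$. $\varphi(0^+)$ denotes $\lim_{x\to0^+}\varphi(x)$. "Best possible coefficients" means that the left inequality fails for some $x\in(0,1/2]$ if $\alpha$ is replaced by any larger constant, and the right inequality fails for some $x\in(0,1/2]$ if $\delta$ is replaced by any smaller constant. *)

theory Defs
  imports "HOL-Analysis.Analysis"
begin

definition R :: "real \<Rightarrow> real" where
  "R x = - 2 * euler_mascheroni - Digamma x - Digamma (1 - x)"

definition B :: "real \<Rightarrow> real" where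
  "B x = Gamma x * Gamma (1 - x)"

definition b\<^sub>0 :: real where
  "b\<^sub>0 = 5 * ln 2 - pi"

definition \<rho> :: real where
  "\<rho> = 4 * b\<^sub>0 / 5"

definition F\<^sub>1 :: "real \<Rightarrow> real" where
  "F\<^sub>1 x = (1 + x * (1 - x)) * (R x / B x)"

definition F\<^sub>2 :: "real \<Rightarrow> real" where
  "F\<^sub>2 x = R x / B x - 1 / (1 + x * (1 - x))"

definition F\<^sub>3 :: "real \<Rightarrow> real" where
  "F\<^sub>3 x = R x - B x / (1 + x * (1 - x))"

text \<open>The library's \<open>Digamma\<close> and the Gamma product above are the functions
  \<open>\<Gamma>'/\<Gamma>\<close> and \<open>\<pi> / sin (\<pi> x)\<close>.\<close>

lemma Digamma_eq_deriv_Gamma: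
  fixes x :: real
  assumes "x > 0"
  shows "Digamma x = deriv Gamma x / Gamma x"
proof -
  have x: "x \<notin> \<int>\<^sub>\<le>\<^sub>0"
    using assms by (auto elim!: nonpos_Ints_cases)
  have "deriv Gamma x = Gamma x * Digamma x"
    by (rule DERIV_imp_deriv[OF has_field_derivative_Gamma[OF x]])
  moreover have "Gamma x \<noteq> 0"
    using Gamma_real_pos[OF assms] by simp
  ultimately show ?thesis by simp
qed

lemma B_eq_sin: "B x = pi / sin (pi * x)"
proof -
  have "complex_of_real (B x) = complex_of_real (pi / sin (pi * x))"
    using Gamma_reflection_complex[of "complex_of_real x"]
    by (simp add: B_def Gamma_complex_of_real[symmetric] flip: sin_of_real)
  then show ?thesis by (simp only: of_real_eq_iff)
qed

end

theory Submission
  imports Defs "HOL-Real_Asymp.Real_Asymp"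
begin

text \<open>
  In terms of \<open>t = x (1 - x)\<close>, pairing the terms of the partial fraction expansions gives
  \<open>B = 1 / (t P)\<close> with \<open>P = (\<Prod>k\<ge>1. 1 + t / (k (k + 1)))\<close> and \<open>R = B - w\<close> with
  \<open>w = (\<Sum>k. c\<^sub>k t / (m\<^sub>k + t))\<close>, \<open>m\<^sub>k = (2 k + 1) (2 k + 2)\<close>, \<open>c\<^sub>k > 0\<close>.
  Hence \<open>R / B = 1 - g\<close> with \<open>g = t w P\<close>. Both \<open>t w\<close> and \<open>P\<close> are
  nonnegative, increasing and convex, so \<open>g\<close> is too. This makes
  \<open>F\<^sub>1 = (1 + t) (1 - g)\<close> and \<open>F\<^sub>2 = 1 - g - 1 / (1 + t)\<close> strictly concave in \<open>t\<close>, hence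
  unimodal, while \<open>F\<^sub>3 = 1 / ((1 + t) P) - w\<close> is convex and decreasing in \<open>t\<close>, hence convex in \<open>x\<close>
  because \<open>t\<close> is concave in \<open>x\<close>. No derivative of a digamma series is needed. The location of the
  peaks only requires the closed forms of \<open>R\<close> at \<open>1 / 4\<close> and \<open>1 / 2\<close> and a few numerical estimates.
\<close>

subsection \<open>Expansions of B and R in x (1 - x)\<close>

text \<open>Logarithmic derivative of the reflection formula: B is differentiated once as a Gamma
  product and once as \<open>pi / sin (pi * x)\<close>, and the two derivatives must agree.\<close>

lemma Digamma_reflection:
  fixes x :: real
  assumes "0 < x" "x < 1"
  shows "Digamma (1 - x) - Digamma x = pi * cos (pi * x) / sin (pi * x)"
proof -
  have s: "sin (pi * x) > 0"
    using assms mult_strict_left_mono[of x 1 pi] by (intro sin_gt_zero) auto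
  have nz: "x \<notin> \<int>\<^sub>\<le>\<^sub>0" "1 - x \<notin> \<int>\<^sub>\<le>\<^sub>0"
    using assms by (auto elim!: nonpos_Ints_cases')
  have B: "B = (\<lambda>x. pi / sin (pi * x))"
    using B_eq_sin by auto
  have "(B has_real_derivative B x * (Digamma x - Digamma (1 - x))) (at x)"
    unfolding B_def [abs_def]
    by (rule derivative_eq_intros nz refl | simp add: nz)+ (simp add: algebra_simps)
  moreover have "(B has_real_derivative B x * - (pi * cos (pi * x) / sin (pi * x))) (at x)"
    unfolding B using s
    by (auto intro!: derivative_eq_intros simp: field_simps power2_eq_square)
  ultimately have "B x * (Digamma x - Digamma (1 - x)) = B x * - (pi * cos (pi * x) / sin (pi * x))"
    by (rule DERIV_unique)
  moreover have "B x \<noteq> 0"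
    using s by (simp add: B)
  ultimately have "Digamma x - Digamma (1 - x) = - (pi * cos (pi * x) / sin (pi * x))"
    by (metis mult_left_cancel)
  thus ?thesis by simp
qed

text \<open>Splitting the first 2m reciprocals at 2z by parity gives half the reciprocals at z and
  at z + 1/2. In the limit formula for \<open>Digamma\<close> the term 2 ln 2 comes from
  \<open>ln (2 * m)\<close>.\<close>

lemma Digamma_duplication:
  fixes z :: real
  assumes "z > 0"
  shows "2 * Digamma (2 * z) = Digamma z + Digamma (z + 1 / 2) + 2 * ln 2"
proof -
  define D where "D z m = ln (real m) - (\<Sum>n<m. inverse (z + real n))" for z :: real and m
  have lim: "D z \<longlonglongrightarrow> Digamma z" if "z > 0" for z
    using Digamma_LIMSEQ[of z] that by (simp add: D_def [abs_def])
  have split: "(\<Sum>n<2*m. inverse (2 * z + real n)) =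
      ((\<Sum>n<m. inverse (z + real n)) + (\<Sum>n<m. inverse (z + 1/2 + real n))) / 2" for m
  proof (induction m)
    case (Suc m)
    have "(\<Sum>n<2 * Suc m. inverse (2 * z + real n)) =
        (\<Sum>n<2*m. inverse (2 * z + real n)) + inverse (2 * z + real (2*m)) + inverse (2 * z + real (2*m+1))"
      by simp
    moreover have "inverse (2 * z + real (2*m)) = inverse (z + real m) / 2"
      using assms by (simp add: field_simps)
    moreover have "inverse (2 * z + real (2*m+1)) = inverse (z + 1/2 + real m) / 2"
      using assms by (simp add: field_simps)
    ultimately show ?case using Suc by simp
  qed simp
  have eq: "2 * D (2 * z) (2 * m) = D z m + D (z + 1/2) m + 2 * ln 2" if "m > 0" for m
    unfolding D_def split using that by (simp add: ln_mult) (simp add: field_simps)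
  have "(\<lambda>m. 2 * D (2 * z) (2 * m)) \<longlonglongrightarrow> 2 * Digamma (2 * z)"
    using assms by (intro tendsto_intros filterlim_compose[OF lim] filterlim_subseq)
      (auto simp: strict_mono_def)
  moreover have "(\<lambda>m. 2 * D (2 * z) (2 * m)) \<longlonglongrightarrow> Digamma z + Digamma (z + 1/2) + 2 * ln 2"
    by (rule Lim_transform_eventually[OF tendsto_add[OF tendsto_add[OF lim lim] tendsto_const]])
      (use assms eq in \<open>auto intro: eventually_mono[OF eventually_gt_at_top[of 0]]\<close>)
  ultimately show ?thesis
    by (rule LIMSEQ_unique)
qed

text \<open>
  \<open>defect (x (1 - x))\<close> is \<open>B x - R x\<close>; and \<open>sine_prod (x (1 - x))\<close> below is \<open>1 / (x (1 - x) B x)\<close>.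
  Both make sense for all \<open>t \<ge> 0\<close>, beyond the range \<open>t \<le> 1 / 4\<close> of \<open>x (1 - x)\<close>.
\<close>

definition defect_term :: "nat \<Rightarrow> real \<Rightarrow> real" where
  "defect_term k t = 2 * (4 * real k + 3) * t /
     ((2 * real k + 1) * (2 * real k + 2) * ((2 * real k + 1) * (2 * real k + 2) + t))"

definition defect :: "real \<Rightarrow> real" where
  "defect t = (\<Sum>k. defect_term k t)"

text \<open>Uses 1 / sin v = cot (v/2) - cot v: reflection at x/2 and at x turns B into digamma
  values, and duplication at x/2 removes \<open>Digamma x\<close> and
  \<open>Digamma (x / 2)\<close>. The two arguments left are exchanged by x -> 1 - x, which is why
  the result depends on x (1 - x) only.\<close>

lemma B_minus_R_eq_Digamma:
  assumes "0 < x" "x < 1"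
  shows "B x - R x = Digamma (1 - x / 2) + Digamma (1 / 2 + x / 2) + 2 * euler_mascheroni + 2 * ln 2"
proof -
  have s: "sin (pi * x / 2) > 0"  "cos (pi * x / 2) > 0"
    using assms mult_strict_left_mono[of x 1 pi] by (auto intro!: sin_gt_zero cos_gt_zero)
  have sd: "sin (pi * x) = 2 * sin (pi * x / 2) * cos (pi * x / 2)"
    using sin_double[of "pi * x / 2"] by simp
  have cd: "cos (pi * x) = 2 * cos (pi * x / 2) ^ 2 - 1"
    using cos_double_cos[of "pi * x / 2"] by simp
  have "B x = pi * cos (pi * (x / 2)) / sin (pi * (x / 2)) - pi * cos (pi * x) / sin (pi * x)"
    unfolding B_eq_sin times_divide_eq_right sd cd using s
    by (simp add: field_simps power2_eq_square)
  also have "\<dots> = (Digamma (1 - x / 2) - Digamma (x / 2)) - (Digamma (1 - x) - Digamma x)"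
    using assms by (simp only: Digamma_reflection)
  finally show ?thesis
    using Digamma_duplication[of "x / 2"] assms by (simp add: R_def add.commute)
qed

lemma defect_term_sums:
  assumes "0 < x" "x < 1"
  shows "(\<lambda>k. defect_term k (x * (1 - x))) sums (B x - R x)"
proof -
  define d :: "real \<Rightarrow> nat \<Rightarrow> real" where "d z k = inverse (real (Suc k)) - inverse (z + real k)" for z k
  have d: "d z sums (Digamma z + euler_mascheroni)" if "z > 0" for z
    using summable_sums[OF summable_Digamma[of z]] that by (simp add: Digamma_def d_def [abs_def])
  \<comment> \<open>Subtracting the series at 1/2 produces the constant 2 ln 2 and leaves the
    reference fraction 1 / (k + 1/2) beside 1 / (k + 1).\<close>
  have "(\<lambda>k. d (1 - x / 2) k + d (1/2 + x / 2) k - d (1/2) k) sums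
    (Digamma (1 - x / 2) + euler_mascheroni + (Digamma (1 / 2 + x / 2) + euler_mascheroni)
      - (Digamma (1 / 2) + euler_mascheroni))"
    using assms by (intro sums_add sums_diff d) auto
  also have "\<dots> = B x - R x"
    using assms Digamma_one_half[where 'a=real] by (simp add: B_minus_R_eq_Digamma)
  also have "(\<lambda>k. d (1 - x / 2) k + d (1/2 + x / 2) k - d (1/2) k) = (\<lambda>k. defect_term k (x * (1 - x)))"
  proof
    fix k
    define K where "K = real k"
    have K: "K \<ge> 0" by (simp add: K_def)
    have add_inverse: "inverse a + inverse b = (a + b) / (a * b)" if "a > 0" "b > 0" for a b :: real
      using that by (simp add: field_simps)
    \<comment> \<open>The pair 1 - x/2, 1/2 + x/2 has the same sum as the pair 1, 1/2, and the
      shifted product involves x only through x (1 - x). Hence the two sums of reciprocals share a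
      numerator and their difference is a single fraction in x (1 - x).\<close>
    have mult: "(1 - x / 2 + K) * (1/2 + x / 2 + K) = ((2*K+1)*(2*K+2) + x * (1-x)) / 4"
      by (simp add: field_simps)
    have pos: "1 - x / 2 + K > 0" "1/2 + x / 2 + K > 0" and sum: "1 - x / 2 + K + (1/2 + x / 2 + K) = 2 * K + 3/2"
      using K assms by auto
    have 1: "inverse (1 - x / 2 + K) + inverse (1/2 + x / 2 + K) =
        (2 * K + 3/2) / (((2*K+1)*(2*K+2) + x * (1-x)) / 4)"
      by (simp only: add_inverse[OF pos] mult sum)
    have mult': "(1 + K) * (1/2 + K) = (2*K+1)*(2*K+2) / 4"
      by (simp add: field_simps)
    have pos': "1 + K > 0" "1/2 + K > 0" and sum': "1 + K + (1/2 + K) = 2 * K + 3/2"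
      using K by auto
    have 2: "inverse (1 + K) + inverse (1/2 + K) = (2 * K + 3/2) / ((2*K+1)*(2*K+2) / 4)"
      by (simp only: add_inverse[OF pos'] mult' sum')
    define m q where "m = (2*K+1)*(2*K+2)" and "q = x * (1-x)"
    have "m > 0" "q > 0" using K assms by (auto simp: m_def q_def)
    hence "(2 * K + 3/2) / (m / 4) - (2 * K + 3/2) / ((m + q) / 4) = 2 * (4 * K + 3) * q / (m * (m + q))"
      by (simp add: divide_simps) (simp add: algebra_simps)
    with 1 2 show "d (1 - x / 2) k + d (1/2 + x / 2) k - d (1/2) k = defect_term k (x * (1 - x))"
      unfolding d_def defect_term_def K_def [symmetric] m_def q_def by (simp add: K_def add_ac)
  qed
  finally show ?thesis .
qed

lemma R_eq_B_minus_defect: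
  assumes "0 < x" "x < 1"
  shows "R x = B x - defect (x * (1 - x))"
  using sums_unique[OF defect_term_sums[OF assms]] by (simp add: defect_def)

section \<open>The product expansion of B\<close>

definition sine_prod :: "real \<Rightarrow> real" where
  "sine_prod t = (\<Prod>k. 1 + t / ((real k + 1) * (real k + 2)))"

lemma summable_inverse_pronic: "summable (\<lambda>k. 1 / ((real k + 1) * (real k + 2)))"
proof (rule summable_comparison_test')
  show "summable (\<lambda>k. 1 / (real k + 1) ^ 2)"
    using sums_summable[OF inverse_squares_sums] by (simp add: add.commute)
qed (auto simp: power2_eq_square intro!: divide_left_mono mult_left_mono)

lemma sine_prod_LIMSEQ:
  assumes "t \<ge> 0"
  shows "(\<lambda>n. \<Prod>k\<le>n. 1 + t / ((real k + 1) * (real k + 2))) \<longlonglongrightarrow> sine_prod t"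
  unfolding sine_prod_def
proof (intro convergent_prod_LIMSEQ summable_imp_convergent_prod_real)
  show "summable (\<lambda>k. \<bar>t / ((real k + 1) * (real k + 2))\<bar>)"
    using summable_mult[OF summable_inverse_pronic, of t] assms by simp
  show "t / ((real k + 1) * (real k + 2)) \<noteq> - 1" for k
  proof -
    have "t / ((real k + 1) * (real k + 2)) \<ge> 0"
      using assms by simp
    thus ?thesis by linarith
  qed
qed

text \<open>Euler's sine product regrouped: with 1 - x^2/k^2 = (1 - x/k) (1 + x/k), the right half
  of one factor meets the left half of the next in (1 + x/k) (1 - x/(k+1)) = 1 + t / (k (k+1)). The
  first half 1 - x is left over, and the factor 1 - x/(n+2) that completes the last pair tends to
  1.\<close>

lemma B_eq_sine_prod:
  assumes "0 < x" "x < 1"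
  shows "B x = 1 / (x * (1 - x) * sine_prod (x * (1 - x)))"
proof -
  define t where "t = x * (1 - x)"
  define f where "f n = (\<Prod>k\<le>n. 1 + t / ((real k + 1) * (real k + 2)))" for n :: nat
  have split: "(\<Prod>k=1..Suc n. 1 - x^2 / of_nat k^2) * (1 - x / (real n + 2)) = (1 - x) * f n" for n
  proof (induction n)
    case 0
    show ?case by (simp add: f_def t_def field_simps power2_eq_square)
  next
    case (Suc n)
    define N where "N = real n + 2"
    have N: "N \<ge> 2" by (simp add: N_def)
    have "(1 - x^2 / N^2) * (1 - x / (N + 1)) = (1 - x / N) * (1 + t / (N * (N + 1)))"
      using N by (simp add: t_def divide_simps) (simp add: algebra_simps power2_eq_square power3_eq_cube)
    hence "(\<Prod>k=1..Suc n. 1 - x^2 / of_nat k^2) * ((1 - x^2 / N^2) * (1 - x / (N + 1)))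
       = (1 - x) * f n * (1 + t / (N * (N + 1)))"
      using Suc by (simp add: N_def mult_ac)
    thus ?case by (simp add: f_def N_def mult_ac add_ac)
  qed
  have "(\<lambda>n. x / (real n + 2)) \<longlonglongrightarrow> 0"
    by real_asymp
  hence "(\<lambda>n. (pi * x * (\<Prod>k=1..Suc n. 1 - x^2 / of_nat k^2)) * (1 - x / (real n + 2)))
      \<longlonglongrightarrow> sin (pi * x) * (1 - 0)"
    by (intro tendsto_intros LIMSEQ_Suc[OF sin_product_formula_real])
  moreover have "(\<lambda>n. pi * x * (1 - x) * f n) \<longlonglongrightarrow> pi * x * (1 - x) * sine_prod t"
    unfolding f_def using assms by (intro tendsto_intros sine_prod_LIMSEQ) (simp add: t_def)
  moreover have "(\<lambda>n. (pi * x * (\<Prod>k=1..Suc n. 1 - x^2 / of_nat k^2)) * (1 - x / (real n + 2)))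
      = (\<lambda>n. pi * x * (1 - x) * f n)"
    using split by (simp add: mult.assoc del: prod.cl_ivl_Suc)
  ultimately have "sin (pi * x) = pi * x * (1 - x) * sine_prod t"
    using LIMSEQ_unique by fastforce
  thus ?thesis
    by (simp add: B_eq_sin t_def mult.assoc)
qed

subsection \<open>Convexity of the building blocks\<close>

lemma convex_on_LIMSEQ:
  assumes "\<And>n. convex_on S (f n)" and "\<And>x. x \<in> S \<Longrightarrow> (\<lambda>n. f n x) \<longlonglongrightarrow> g x"
  shows "convex_on S g"
proof (rule convex_onI)
  show S: "convex S"
    using assms(1) convex_on_imp_convex by blast
  fix t x y assume *: "0 < t" "t < (1::real)" "x \<in> S" "y \<in> S"
  hence "(1 - t) *\<^sub>R x + t *\<^sub>R y \<in> S"
    using S by (simp add: convex_alt)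
  hence "(\<lambda>n. f n ((1 - t) *\<^sub>R x + t *\<^sub>R y)) \<longlonglongrightarrow> g ((1 - t) *\<^sub>R x + t *\<^sub>R y)"
    by (rule assms)
  moreover have "(\<lambda>n. (1 - t) * f n x + t * f n y) \<longlonglongrightarrow> (1 - t) * g x + t * g y"
    using * by (intro tendsto_intros assms)
  ultimately show "g ((1 - t) *\<^sub>R x + t *\<^sub>R y) \<le> (1 - t) * g x + t * g y"
    by (rule LIMSEQ_le) (use * in \<open>auto intro!: convex_onD[OF assms(1)]\<close>)
qed

text \<open>Multiplying the two chords gives the chord of the product minus a multiple of the
  product of the increments, which is nonnegative because both functions move in the same
  direction.\<close>

lemma convex_on_mul_antimono:
  fixes S :: "real set"
  assumes f: "convex_on S f" "antimono_on S f" "\<And>x. x \<in> S \<Longrightarrow> f x \<ge> 0"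
    and g: "convex_on S g" "antimono_on S g" "\<And>x. x \<in> S \<Longrightarrow> g x \<ge> 0"
  shows "convex_on S (\<lambda>x. f x * g x)"
proof (rule convex_on_linorderI)
  show S: "convex S"
    using f(1) by (rule convex_on_imp_convex)
  fix t x y assume t: "0 < t" "t < (1::real)" and xy: "x \<in> S" "y \<in> S" "x < y"
  define z where "z = (1 - t) *\<^sub>R x + t *\<^sub>R y"
  have z: "z \<in> S"
    using S t xy by (simp add: z_def convex_alt)
  have "f z * g z \<le> ((1 - t) * f x + t * f y) * ((1 - t) * g x + t * g y)"
    using t xy z f(3) g(3) convex_onD[OF f(1), of t x y] convex_onD[OF g(1), of t x y]
    by (intro mult_mono) (auto simp: z_def intro!: add_nonneg_nonneg mult_nonneg_nonneg)
  also have "\<dots> = (1 - t) * (f x * g x) + t * (f y * g y) - t * (1 - t) * ((f x - f y) * (g x - g y))"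
    by (simp add: algebra_simps)
  also have "\<dots> \<le> (1 - t) * (f x * g x) + t * (f y * g y)"
    using t xy f(2) g(2) by (auto simp: monotone_on_def)
  finally show "f ((1 - t) *\<^sub>R x + t *\<^sub>R y) * g ((1 - t) *\<^sub>R x + t *\<^sub>R y)
      \<le> (1 - t) * (f x * g x) + t * (f y * g y)"
    by (simp add: z_def)
qed

lemma convex_on_cong:
  assumes "convex_on S f" and "\<And>x. x \<in> S \<Longrightarrow> f x = g x"
  shows "convex_on S g"
proof (rule convex_onI)
  show S: "convex S"
    using assms(1) by (rule convex_on_imp_convex)
  fix t x y assume *: "0 < t" "t < (1::real)" "x \<in> S" "y \<in> S"
  hence "(1 - t) *\<^sub>R x + t *\<^sub>R y \<in> S"
    using S by (simp add: convex_alt)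
  thus "g ((1 - t) *\<^sub>R x + t *\<^sub>R y) \<le> (1 - t) * g x + t * g y"
    using convex_onD[OF assms(1), of t x y] * assms(2) by simp
qed

lemma convex_on_sum_fun:
  assumes "convex S" and "\<And>k. k \<in> A \<Longrightarrow> convex_on S (f k)"
  shows "convex_on S (\<lambda>x. \<Sum>k\<in>A. f k x)"
  using assms(2) by (induction A rule: infinite_finite_induct) (auto simp: assms(1) convex_on_const)

section \<open>Monotonicity and convexity of the defect series\<close>

lemma summable_defect_term:
  assumes "t \<ge> 0"
  shows "summable (\<lambda>k. defect_term k t)"
proof (rule summable_comparison_test')
  show "summable (\<lambda>k. 8 * t * (1 / ((real k + 1) * (real k + 2))))"
    by (intro summable_mult summable_inverse_pronic)
  fix k :: nat
  define K where "K = real k"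
  have K: "K \<ge> 0" by (simp add: K_def)
  define M where "M = (2 * K + 1) * (2 * K + 2)"
  have M: "M > 0" using K by (simp add: M_def)
  \<comment> \<open>With the constant 8 the difference has only positive coefficients in K, so it is
    nonnegative at sight.\<close>
  have "8 * (M * M) - 2 * (4 * K + 3) * ((K + 1) * (K + 2)) = 128 * K^4 + 376 * K^3 + 386 * K^2 + 158 * K + 20"
    unfolding M_def by (simp add: algebra_simps power2_eq_square power3_eq_cube power4_eq_xxxx)
  hence "2 * (4 * K + 3) * ((K + 1) * (K + 2)) \<le> 8 * (M * M)"
    using K by (smt (verit) zero_le_power mult_nonneg_nonneg)
  moreover have "(K + 1) * (K + 2) > 0"
    using K by simp
  ultimately have "2 * (4 * K + 3) / (M * M) \<le> 8 / ((K + 1) * (K + 2))"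
    using M by (subst pos_divide_le_eq) (simp_all only: pos_le_divide_eq mult_pos_pos times_divide_eq_left)
  hence "t * (2 * (4 * K + 3) / (M * M)) \<le> t * (8 / ((K + 1) * (K + 2)))"
    using assms by (rule mult_left_mono)
  moreover have "2 * (4 * K + 3) * t / (M * (M + t)) \<le> 2 * (4 * K + 3) * t / (M * M)"
    using K M assms by (intro divide_left_mono mult_left_mono) auto
  moreover have "2 * (4 * K + 3) * t / (M * (M + t)) \<ge> 0"
    using K M assms by simp
  ultimately show "norm (defect_term k t) \<le> 8 * t * (1 / ((real k + 1) * (real k + 2)))"
    unfolding defect_term_def K_def [symmetric] M_def [symmetric]
    by (simp only: real_norm_def abs_of_nonneg) (simp add: mult_ac)
qed

lemma defect_term_0 [simp]: "defect_term k 0 = 0"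
  by (simp add: defect_term_def)

lemma defect_0 [simp]: "defect 0 = 0"
  by (simp add: defect_def)

text \<open>Partial fractions, affine in \<open>inverse (m + t)\<close> up to a linear term. The
  coefficient of this convex function is negative for the term itself and positive after
  multiplication by t, so the term is concave while t times the term is convex.\<close>

lemma defect_term_eq:
  fixes k :: nat and t :: real
  defines "m \<equiv> (2 * real k + 1) * (2 * real k + 2)"
  assumes "t \<ge> 0"
  shows "defect_term k t = 2 * (4 * real k + 3) * (1 / m - inverse (m + t))"
    and "t * defect_term k t = 2 * (4 * real k + 3) * (t / m - 1 + m * inverse (m + t))"
proof -
  have m: "m > 0" by (simp add: m_def)
  have 1: "t / (m * (m + t)) = 1 / m - inverse (m + t)"
    and 2: "t * t / (m * (m + t)) = t / m - 1 + m * inverse (m + t)"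
    using m assms(2) by (simp_all add: field_simps)
  show "defect_term k t = 2 * (4 * real k + 3) * (1 / m - inverse (m + t))"
    unfolding 1 [symmetric] by (simp add: defect_term_def m_def)
  show "t * defect_term k t = 2 * (4 * real k + 3) * (t / m - 1 + m * inverse (m + t))"
    unfolding 2 [symmetric] by (simp add: defect_term_def m_def mult_ac)
qed

lemma convex_on_inverse_shift:
  fixes m :: real assumes "m > 0" 
  shows "convex_on {0..} (\<lambda>t. inverse (m + t))"
proof (rule convex_onI)
  have conv: "convex_on {m..} inverse"
    by (rule convex_on_inverse) (use assms in auto)
  fix t x y :: real assume *: "0 < t" "t < 1" "x \<in> {0..}" "y \<in> {0..}"
  have "m + ((1 - t) *\<^sub>R x + t *\<^sub>R y) = (1 - t) *\<^sub>R (m + x) + t *\<^sub>R (m + y)"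
    by (simp add: algebra_simps)
  thus "inverse (m + ((1 - t) *\<^sub>R x + t *\<^sub>R y)) \<le> (1 - t) * inverse (m + x) + t * inverse (m + y)"
    using convex_onD[OF conv, of t "m + x" "m + y"] * by simp
qed auto

lemma defect_term_strict_mono:
  assumes "0 \<le> s" "s < t"
  shows "defect_term k s < defect_term k t"
proof -
  have "(2 * real k + 1) * (2 * real k + 2) > 0" by simp
  thus ?thesis
    using assms by (auto simp: defect_term_eq intro!: mult_strict_left_mono less_imp_inverse_less add_pos_nonneg)
qed

lemma defect_strict_mono:
  assumes "0 \<le> s" "s < t"
  shows "defect s < defect t"
proof -
  have "(\<Sum>k. defect_term k t - defect_term k s) > 0"
    using assms by (intro suminf_pos summable_diff summable_defect_term) (auto simp: defect_term_strict_mono)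
  also have "(\<Sum>k. defect_term k t - defect_term k s) = defect t - defect s"
    unfolding defect_def using assms by (intro suminf_diff [symmetric] summable_defect_term) auto
  finally show ?thesis by simp
qed

text \<open>Every tail is a limit of sums of concave terms. The case n = 0 is the whole defect; n =
  2 serves the numerical bounds, where two terms are kept exactly.\<close>

lemma concave_on_defect_remainder: "concave_on {0..} (\<lambda>t. defect t - (\<Sum>k<n. defect_term k t))"
  unfolding concave_on_def
proof (rule convex_on_LIMSEQ)
  show "convex_on {0..} (\<lambda>t. \<Sum>k<N. - defect_term (k + n) t)" for N
  proof (rule convex_on_sum_fun)
    fix k :: nat
    define k' m where "k' = k + n" and "m = (2 * real k' + 1) * (2 * real k' + 2)"
    have "m > 0" by (simp add: m_def)
    hence "convex_on {0..} (\<lambda>t. 2 * (4 * real k' + 3) * (inverse (m + t) + - (1 / m)))"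
      by (intro convex_on_cmul convex_on_add convex_on_inverse_shift) (auto simp: convex_on_const)
    thus "convex_on {0..} (\<lambda>t. - defect_term (k + n) t)"
      unfolding k'_def [symmetric]
      by (rule convex_on_cong) (simp add: defect_term_eq m_def algebra_simps)
  qed auto
  show "(\<lambda>N. \<Sum>k<N. - defect_term (k + n) t) \<longlonglongrightarrow> - (defect t - (\<Sum>k<n. defect_term k t))"
    if "t \<in> {0..}" for t
    using tendsto_minus[OF summable_LIMSEQ[OF summable_ignore_initial_segment[OF summable_defect_term[of t], of n]]]
      suminf_minus_initial_segment[OF summable_defect_term[of t], of n] that
    by (simp add: defect_def sum_negf)
qed

lemma concave_on_defect: "concave_on {0..} defect"
  using concave_on_defect_remainder[of 0] by simp

lemma convex_on_mult_defect: "convex_on {0..} (\<lambda>t. t * defect t)"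
proof (rule convex_on_LIMSEQ)
  show "convex_on {0..} (\<lambda>t. \<Sum>k<n. t * defect_term k t)" for n
  proof (rule convex_on_sum_fun)
    fix k
    define m where "m = (2 * real k + 1) * (2 * real k + 2)"
    have "m > 0" by (simp add: m_def)
    hence "convex_on {0..} (\<lambda>t. 2 * (4 * real k + 3) * ((t / m + - 1) + m * inverse (m + t)))"
      by (intro convex_on_cmul convex_on_add convex_on_inverse_shift convex_on_cdiv)
        (auto simp: convex_on_const convex_on_ident)
    thus "convex_on {0..} (\<lambda>t. t * defect_term k t)"
      by (rule convex_on_cong) (simp add: defect_term_eq(2) m_def)
  qed auto
  show "(\<lambda>n. \<Sum>k<n. t * defect_term k t) \<longlonglongrightarrow> t * defect t" if "t \<in> {0..}" for t
    using summable_LIMSEQ[OF summable_defect_term[of t]] that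
    by (auto simp: defect_def simp flip: sum_distrib_left intro!: tendsto_mult)
qed

section \<open>Monotonicity and convexity of the product and of its reciprocal\<close>

lemma sine_prod_0 [simp]: "sine_prod 0 = 1"
  by (simp add: sine_prod_def)

lemma sine_prod_mono:
  assumes "0 \<le> s" "s \<le> t"
  shows "sine_prod s \<le> sine_prod t"
  by (rule LIMSEQ_le[OF sine_prod_LIMSEQ sine_prod_LIMSEQ])
    (use assms in \<open>auto intro!: exI[of _ 0] prod_mono divide_right_mono add_nonneg_nonneg\<close>)

lemma sine_prod_ge_1: "t \<ge> 0 \<Longrightarrow> sine_prod t \<ge> 1"
  using sine_prod_mono[of 0 t] by simp

text \<open>The factors are affine, nonnegative and increasing. Monotonicity is carried through the
  induction because the product rule for convexity asks for factors that vary in the same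
  direction.\<close>

lemma convex_on_sine_prod: "convex_on {0..} sine_prod"
proof (rule convex_on_LIMSEQ[OF _ sine_prod_LIMSEQ])
  have "convex_on {0..} (\<lambda>t. \<Prod>k\<in>A. 1 + t / ((real k + 1) * (real k + 2)))
      \<and> mono_on {0..} (\<lambda>t. \<Prod>k\<in>A. 1 + t / ((real k + 1) * (real k + 2)))" if "finite A" for A
    using that
  proof induction
    case (insert k A)
    define c where "c = (real k + 1) * (real k + 2)"
    have "c > 0" by (simp add: c_def)
    hence "convex_on {0..} (\<lambda>t. 1 + t / c)" "mono_on {0..} (\<lambda>t. 1 + t / c)"
      by (auto intro!: convex_on_add convex_on_cdiv simp: convex_on_const convex_on_ident
          monotone_on_def divide_right_mono)
    moreover have "(\<lambda>t. 1 + t / c) \<in> {0..} \<rightarrow> {0..}"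
        "(\<lambda>t. \<Prod>k\<in>A. 1 + t / ((real k + 1) * (real k + 2))) \<in> {0..} \<rightarrow> {0..}"
      using \<open>c > 0\<close> by (auto intro!: prod_nonneg)
    ultimately have "convex_on {0..} (\<lambda>t. (1 + t / c) * (\<Prod>k\<in>A. 1 + t / ((real k + 1) * (real k + 2))))"
      using insert by (intro convex_on_mul) auto
    moreover have "mono_on {0..} (\<lambda>t. \<Prod>k\<in>insert k A. 1 + t / ((real k + 1) * (real k + 2)))"
      by (auto simp: monotone_on_def intro!: prod_mono divide_right_mono)
    ultimately show ?case
      using insert by (simp add: c_def)
  qed (auto simp: convex_on_const monotone_on_def)
  thus "convex_on {0..} (\<lambda>t. \<Prod>k\<le>n. 1 + t / ((real k + 1) * (real k + 2)))" for n
    by auto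
qed auto

text \<open>Each reciprocal factor is c / (c + t), nonnegative, convex and decreasing, so
  \<open>convex_on_mul_antimono\<close> applies along the induction.\<close>

lemma convex_on_inverse_sine_prod: "convex_on {0..} (\<lambda>t. inverse (sine_prod t))"
proof (rule convex_on_LIMSEQ)
  have "convex_on {0..} (\<lambda>t. \<Prod>k\<in>A. inverse (1 + t / ((real k + 1) * (real k + 2))))
      \<and> antimono_on {0..} (\<lambda>t. \<Prod>k\<in>A. inverse (1 + t / ((real k + 1) * (real k + 2))))" if "finite A" for A
    using that
  proof induction
    case (insert k A)
    define c where "c = (real k + 1) * (real k + 2)"
    have c: "c > 0" by (simp add: c_def)
    have "convex_on {0..} (\<lambda>t. c * inverse (c + t))"
      using c by (intro convex_on_cmul convex_on_inverse_shift) auto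
    hence "convex_on {0..} (\<lambda>t. inverse (1 + t / c))"
      by (rule convex_on_cong) (use c in \<open>auto simp: field_simps\<close>)
    moreover have "antimono_on {0..} (\<lambda>t. inverse (1 + t / c))"
      using c by (auto simp: monotone_on_def intro!: le_imp_inverse_le divide_right_mono add_pos_nonneg)
    moreover have "inverse (1 + t / c) \<ge> 0" 
        "(\<Prod>k\<in>A. inverse (1 + t / ((real k + 1) * (real k + 2)))) \<ge> 0" if "t \<in> {0..}" for t
      using that c by (auto intro!: prod_nonneg)
    ultimately have "convex_on {0..} (\<lambda>t. inverse (1 + t / c) *
        (\<Prod>k\<in>A. inverse (1 + t / ((real k + 1) * (real k + 2)))))"
      using insert by (intro convex_on_mul_antimono) auto
    moreover have "antimono_on {0..} (\<lambda>t. \<Prod>k\<in>insert k A. inverse (1 + t / ((real k + 1) * (real k + 2))))"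
      by (auto simp: monotone_on_def intro!: prod_mono le_imp_inverse_le divide_right_mono add_pos_nonneg)
    ultimately show ?case
      using insert by (simp add: c_def)
  qed (auto simp: convex_on_const monotone_on_def)
  thus "convex_on {0..} (\<lambda>t. \<Prod>k\<le>n. inverse (1 + t / ((real k + 1) * (real k + 2))))" for n
    by auto
  show "(\<lambda>n. \<Prod>k\<le>n. inverse (1 + t / ((real k + 1) * (real k + 2)))) \<longlonglongrightarrow> inverse (sine_prod t)"
    if "t \<in> {0..}" for t
    using tendsto_inverse[OF sine_prod_LIMSEQ[of t]] sine_prod_ge_1[of t] that
    by (auto simp: prod_inversef [symmetric] o_def)
qed

subsection \<open>Unimodality from strict concavity\<close>

definition strict_concave_on :: "real set \<Rightarrow> (real \<Rightarrow> real) \<Rightarrow> bool" where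
  "strict_concave_on S h \<longleftrightarrow> (\<forall>a\<in>S. \<forall>b\<in>S. \<forall>u\<in>{0<..<1}. a < b \<longrightarrow>
     (1 - u) * h a + u * h b < h ((1 - u) * a + u * b))"

text \<open>Three-point form without division, so that later comparisons are linear in the values of
  h. The weight u is the relative position of z in [a, b].\<close>

lemma strict_concave_onD:
  assumes "strict_concave_on S h" "a \<in> S" "b \<in> S" "a < z" "z < b"
  shows "(b - z) * h a + (z - a) * h b < (b - a) * h z"
proof -
  define u where "u = (z - a) / (b - a)"
  have u: "0 < u" "u < 1" and z: "u * (b - a) = z - a"
    using assms(4,5) by (simp_all add: u_def)
  have z': "(1 - u) * a + u * b = z"
    using z by (simp add: algebra_simps)
  have "(b - a) * ((1 - u) * h a + u * h b) < (b - a) * h z"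
    using assms u z' by (intro mult_strict_left_mono) (force simp: strict_concave_on_def)+
  moreover have "(b - a) * ((1 - u) * h a + u * h b) = (b - a - u * (b - a)) * h a + u * (b - a) * h b"
    by (simp add: algebra_simps)
  ultimately show ?thesis by (simp add: z)
qed

lemma strict_concave_imp_concave:
  assumes "strict_concave_on S h" "convex S"
  shows "concave_on S h"
proof (rule concave_on_linorderI)
  fix t x y :: real
  assume "0 < t" "t < 1" "x \<in> S" "y \<in> S" "x < y"
  thus "(1 - t) * h x + t * h y \<le> h ((1 - t) *\<^sub>R x + t *\<^sub>R y)"
    using assms(1) by (simp add: strict_concave_on_def less_imp_le)
qed (fact assms(2))

text \<open>A point s higher than both ends traps a maximiser t over [p, q] strictly inside. Strict
  concavity makes t the only maximiser on the whole half-line, and chords ending at t then give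
  strict monotonicity on each side. With p > 0 the interval lies in the open half-line, where
  concavity yields continuity.\<close>

lemma strict_concave_unimodal:
  assumes sc: "strict_concave_on {0..} h" and p: "0 < p" "p < s" "s < q" and hs: "h p < h s" "h q < h s"
  obtains t where "p < t" "t < q" "strict_mono_on {0..t} h" "strict_antimono_on {t..} h"
proof -
  have "concave_on {0<..} h"
    using strict_concave_imp_concave[OF sc]
    by (auto simp: concave_on_def intro: convex_on_subset)
  hence "continuous_on {0<..} (\<lambda>x. - h x)"
    unfolding concave_on_def by (intro convex_on_continuous) auto
  hence "continuous_on {0<..} h"
    using continuous_on_minus by fastforce
  hence "continuous_on {p..q} h"
    by (rule continuous_on_subset) (use p in auto)
  then obtain t where t: "t \<in> {p..q}" and max: "\<And>r. r \<in> {p..q} \<Longrightarrow> h r \<le> h t"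
    using continuous_attains_sup[of "{p..q}" h] p by force
  have "h s \<le> h t" using max p by simp
  hence tpq: "p < t" "t < q"
    using t hs by (auto simp: less_le)
  have less: "h r < h t" if r: "r \<ge> 0" "r \<noteq> t" for r
  proof (rule ccontr)
    assume "\<not> h r < h t"
    hence ge: "h r \<ge> h t" by simp
    show False
    proof (cases "r < t")
      case True
      \<comment> \<open>This z lies strictly between r and t and still in [p, q], so
        \<open>h z \<le> h t\<close>; but \<open>h r \<ge> h t\<close> and strict concavity would
        force h z above h t.\<close>
      define z where "z = max p ((r + t) / 2)"
      have z: "r < z" "z < t" "h z \<le> h t"
        using True tpq by (auto simp: z_def intro!: max) (auto simp: max_def split: if_splits)
      have "(t - z) * h r + (z - r) * h t < (t - r) * h z"
        by (rule strict_concave_onD[OF sc]) (use z r in auto)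
      also have "\<dots> \<le> (t - r) * h t"
        using True z by (intro mult_left_mono) auto
      finally have "(t - z) * h r < (t - z) * h t"
        by (simp add: algebra_simps)
      thus False using ge z by simp
    next
      case False
      define z where "z = min q ((r + t) / 2)"
      have z: "t < z" "z < r" "h z \<le> h t"
        using False r tpq by (auto simp: z_def intro!: max) (auto simp: min_def split: if_splits)
      have "(r - z) * h t + (z - t) * h r < (r - t) * h z"
        by (rule strict_concave_onD[OF sc]) (use z p tpq in auto)
      also have "\<dots> \<le> (r - t) * h t"
        using False z by (intro mult_left_mono) auto
      finally have "(z - t) * h r < (z - t) * h t"
        by (simp add: algebra_simps)
      thus False using ge z by simp
    qed
  qed
  have "h a < h b" if ab: "0 \<le> a" "a < b" "b \<le> t" for a b
  proof (cases "b = t")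
    case False
    have "(t - b) * h a + (b - a) * h t < (t - a) * h b"
      by (rule strict_concave_onD[OF sc]) (use False ab in auto)
    moreover have "(b - a) * h a \<le> (b - a) * h t"
      using less[of a] ab by (intro mult_left_mono) auto
    ultimately have "(t - a) * h a < (t - a) * h b"
      by (simp add: algebra_simps)
    thus ?thesis using ab by simp
  qed (use less ab in auto)
  moreover have "h b < h a" if ab: "t \<le> a" "a < b" for a b
  proof (cases "a = t")
    case False
    have "(b - a) * h t + (a - t) * h b < (b - t) * h a"
      by (rule strict_concave_onD[OF sc]) (use False ab p tpq in auto)
    moreover have "(b - a) * h b \<le> (b - a) * h t"
      using less[of b] ab p tpq by (intro mult_left_mono) auto
    ultimately have "(b - t) * h b < (b - t) * h a"
      by (simp add: algebra_simps)
    thus ?thesis using ab by simp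
  qed (use less[of b] p ab tpq in auto)
  ultimately show ?thesis
    using that tpq by (simp add: monotone_on_def)
qed

section \<open>The substitution t = x (1 - x) and the shape of composed functions\<close>

lemma times_one_minus_less:
  fixes x y :: real
  assumes "x < y" "y \<le> 1 / 2"
  shows "x * (1 - x) < y * (1 - y)"
proof -
  have "(y - x) * (1 - x - y) > 0" using assms by simp
  thus ?thesis by (simp add: algebra_simps)
qed

lemma times_one_minus_bounds:
  fixes x :: real
  assumes "x \<in> {0<..1/2}"
  shows "0 < x * (1 - x)" "x * (1 - x) \<le> 1 / 4"
proof -
  show "0 < x * (1 - x)"
    using assms by simp
  have "(1/2 - x)\<^sup>2 \<ge> 0" by simp
  thus "x * (1 - x) \<le> 1 / 4"
    by (simp add: algebra_simps power2_eq_square)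
qed

lemma times_one_minus_preimage:
  assumes "0 < t" "t \<le> (1/4 :: real)"
  obtains x where "x \<in> {0<..1/2}" "x * (1 - x) = t"
proof
  have "sqrt (1/4 - t) < sqrt ((1/2)\<^sup>2)"
    using assms by (intro real_sqrt_less_mono) (simp add: power2_eq_square)
  thus "1/2 - sqrt (1/4 - t) \<in> {0<..1/2}"
    using assms by simp
  show "(1/2 - sqrt (1/4 - t)) * (1 - (1/2 - sqrt (1/4 - t))) = t"
    using assms by (simp add: algebra_simps)
qed

lemma unimodal_comp_times_one_minus:
  fixes F h :: "real \<Rightarrow> real"
  assumes F: "\<And>x. x \<in> {0<..1/2} \<Longrightarrow> F x = h (x * (1 - x))"
    and t: "0 < t" "t < 1/4" and h: "strict_mono_on {0..t} h" "strict_antimono_on {t..} h"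
  obtains x where "x \<in> {0<..<1/2}" "x * (1 - x) = t"
    "strict_mono_on {0<..x} F" "strict_antimono_on {x..1/2} F"
proof -
  obtain x where x: "x \<in> {0<..1/2}" "x * (1 - x) = t"
    using times_one_minus_preimage[of t] t by auto
  have "x \<noteq> 1/2"
  proof
    assume "x = 1/2"
    hence "x * (1 - x) = 1/2 * (1 - 1/2)" by (simp only:)
    hence "x * (1 - x) = 1/4" by simp
    thus False using x t by simp
  qed
  hence x': "x \<in> {0<..<1/2}" using x by auto
  have le: "a * (1 - a) \<le> b * (1 - b)" if "a \<le> b" "b \<le> 1/2" for a b :: real
    using that times_one_minus_less[of a b] by (cases "a = b") auto
  have "strict_mono_on {0<..x} F"
  proof (rule monotone_onI)
    fix a b assume ab: "a \<in> {0<..x}" "b \<in> {0<..x}" "a < b"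
    have "h (a * (1 - a)) < h (b * (1 - b))"
      using ab x times_one_minus_less[of a b] times_one_minus_bounds(1)[of a] times_one_minus_bounds(1)[of b]
        le[of a x] le[of b x]
      by (intro monotone_onD[OF h(1)]) auto
    thus "F a < F b" using ab x by (simp add: F)
  qed
  moreover have "strict_antimono_on {x..1/2} F"
  proof (rule monotone_onI)
    fix a b assume ab: "a \<in> {x..1/2}" "b \<in> {x..1/2}" "a < b"
    have "h (b * (1 - b)) < h (a * (1 - a))"
      using ab x times_one_minus_less[of a b] le[of x a] le[of x b]
      by (intro monotone_onD[OF h(2)]) auto
    thus "F b < F a" using ab x by (simp add: F)
  qed
  ultimately show ?thesis using that x x' by blast
qed

text \<open>Between two distinct peaks F would be both strictly increasing and strictly
  decreasing.\<close>

lemma unimodal_peak_unique: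
  fixes F :: "real \<Rightarrow> real"
  assumes "x \<in> {l<..<r}" "strict_mono_on {l<..x} F" "strict_antimono_on {x..r} F"
    and "y \<in> {l<..<r}" "strict_mono_on {l<..y} F" "strict_antimono_on {y..r} F"
  shows "x = y"
proof -
  have False if "x < y" "x \<in> {l<..<r}" "y \<in> {l<..<r}"
    "strict_mono_on {l<..y} F" "strict_antimono_on {x..r} F" for x y
    using monotone_onD[OF that(4), of x y] monotone_onD[OF that(5), of x y] that by auto
  thus ?thesis using assms by (meson linorder_neqE_linordered_idom)
qed

text \<open>The peak value exceeds the values at both x/2 and r, whereas convexity would bound it by
  the larger of them. The weight u solves (1 - u) x/2 + u r = x.\<close>

lemma unimodal_not_convex:
  fixes F :: "real \<Rightarrow> real"
  assumes "x \<in> {0<..<r}" "strict_mono_on {0<..x} F" "strict_antimono_on {x..r} F"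
  shows "\<not> convex_on {0<..r} F"
proof
  assume cx: "convex_on {0<..r} F"
  define u where "u = (x / 2) / (r - x / 2)"
  have u: "0 \<le> u" "u \<le> 1" and "r - x / 2 \<noteq> 0"
    using assms(1) by (simp_all add: u_def)
  hence "u * (r - x / 2) = x / 2"
    using nonzero_eq_divide_eq[of "r - x / 2" u "x / 2"] u_def by blast
  hence "x / 2 + u * (r - x / 2) = x" by simp
  hence ux: "(1 - u) * (x / 2) + u * r = x"
    by (simp only: ring_distribs)
  have "F x \<le> (1 - u) * F (x / 2) + u * F r"
    using convex_onD[OF cx, of u "x / 2" r] u ux assms(1) by simp
  also have "\<dots> \<le> max (F (x / 2)) (F r)"
    using u by (intro convex_bound_le) auto
  finally show False
    using monotone_onD[OF assms(2), of "x / 2" x] monotone_onD[OF assms(3), of x r] assms(1) by auto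
qed

text \<open>
  The concave \<open>h\<close> extends beyond \<open>1 / 4\<close> and so is Lipschitz from the left there. Hence
  \<open>F x - F (1 / 2)\<close> is at most of order \<open>(1 / 2 - x)\<^sup>2\<close>, whereas a concave \<open>F\<close> with
  \<open>F x > F (1 / 2)\<close> somewhere would exceed \<open>F (1 / 2)\<close> by a linear amount.
\<close>

lemma strict_concave_comp_not_concave:
  fixes F h :: "real \<Rightarrow> real"
  assumes F: "\<And>x. x \<in> {0<..1/2} \<Longrightarrow> F x = h (x * (1 - x))"
    and sc: "strict_concave_on {0..} h" and s: "0 < s" "s < 1/4" "h (1/4) < h s"
  shows "\<not> concave_on {0<..1/2} F"
proof
  assume cc: "concave_on {0<..1/2} F"
  obtain x where x: "x \<in> {0<..1/2}" "x * (1 - x) = s"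
    using times_one_minus_preimage[of s] s by auto
  define d D M where "d = h s - h (1/4)" and "D = (1/2 - x)\<^sup>2" and "M = h (1/4) - h (1/2)"
  have "x \<noteq> 1/2"
  proof
    assume "x = 1/2"
    hence "x * (1 - x) = 1/2 * (1 - 1/2)" by (simp only:)
    hence "x * (1 - x) = 1/4" by simp
    thus False using x s by simp
  qed
  hence D: "D > 0" by (simp add: D_def)
  have d: "d > 0" using s by (simp add: d_def)
  \<comment> \<open>At z = 1/2 - e (1/2 - x), concavity of F gives a gain of at least e d over F
    (1/2). Concavity of h at z (1 - z) < 1/4 < 1/2 bounds the same gain by 4 e^2 D M, because 1/4 -
    z (1 - z) = e^2 D.\<close>
  have key: "d \<le> 4 * e * D * M" if e: "0 < e" "e < 1" for e
  proof -
    define z where "z = (1 - e) * (1/2) + e * x"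
    have "z = 1/2 - e * (1/2 - x)"
      by (simp add: z_def field_simps)
    moreover have "e * (1/2 - x) \<le> 1 * (1/2 - x)" "0 \<le> e * (1/2 - x)"
      using e x by (intro mult_right_mono mult_nonneg_nonneg; simp)+
    ultimately have z: "z \<in> {0<..1/2}"
      using x by auto
    have zz: "z * (1 - z) = 1/4 - e\<^sup>2 * D"
      by (simp add: z_def D_def field_simps power2_eq_square)
    have "(1 - e) * F (1/2) + e * F x \<le> F z"
      using concave_onD[OF cc, of e "1/2" x] e x by (simp add: z_def)
    moreover have "F (1/2) = h (1/4)" "F x = h s" "F z = h (z * (1 - z))"
      using F[of "1/2"] F[OF x(1)] F[OF z] x(2) by simp_all
    ultimately have 1: "e * d \<le> h (z * (1 - z)) - h (1/4)"
      by (simp only: d_def) (simp add: algebra_simps)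
    have "(1/2 - 1/4) * h (z * (1 - z)) + (1/4 - z * (1 - z)) * h (1/2) < (1/2 - z * (1 - z)) * h (1/4)"
      using times_one_minus_bounds(1)[OF z] D e by (intro strict_concave_onD[OF sc]) (auto simp: zz)
    hence "h (z * (1 - z)) - h (1/4) < 4 * (1/4 - z * (1 - z)) * M"
      by (simp add: M_def algebra_simps)
    moreover have "4 * (1/4 - z * (1 - z)) * M = e * (4 * e * D * M)"
      unfolding zz by (simp add: power2_eq_square)
    ultimately have "e * d < e * (4 * e * D * M)"
      using 1 by linarith
    thus ?thesis using e by simp
  qed
  have "4 * (1/2) * D * M \<ge> d"
    by (rule key) auto
  hence DM: "D * M > 0" using d by simp
  \<comment> \<open>This choice makes 4 e D M less than d/2 and contradicts \<open>key\<close>; the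
    case e = 1/2 above secured D M > 0.\<close>
  define e where "e = d / (d + 8 * (D * M))"
  have "e * (d + 8 * (D * M)) = d" and e: "0 < e" "e < 1"
    using DM d by (auto simp: e_def)
  moreover have "e * (d + 8 * (D * M)) = e * d + 8 * (e * (D * M))" "4 * e * D * M = 4 * (e * (D * M))"
    by (simp_all add: algebra_simps)
  moreover have "e * d > 0" "e * (D * M) > 0"
    using e d DM by (auto intro: mult_pos_pos)
  ultimately have "d > 4 * e * D * M"
    by linarith
  with key[OF e] show False by simp
qed

subsection \<open>The three functions in terms of x (1 - x)\<close>

text \<open>At t = x (1 - x) this is 1 - R x / B x, the function g of the overview.\<close>

definition relative_defect :: "real \<Rightarrow> real" where
  "relative_defect t = t * defect t * sine_prod t"

lemma relative_defect_0 [simp]: "relative_defect 0 = 0"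
  by (simp add: relative_defect_def)

lemma defect_nonneg: "t \<ge> 0 \<Longrightarrow> defect t \<ge> 0"
  using defect_strict_mono[of 0 t] by (cases "t = 0") auto

lemma relative_defect_nonneg: "t \<ge> 0 \<Longrightarrow> relative_defect t \<ge> 0"
  using sine_prod_ge_1[of t] defect_nonneg[of t] by (simp add: relative_defect_def)

lemma mult_defect_mono: "0 \<le> s \<Longrightarrow> s < t \<Longrightarrow> s * defect s < t * defect t"
  using defect_strict_mono[of s t] defect_nonneg[of s] by (intro mult_strict_mono') auto

lemma relative_defect_strict_mono:
  assumes "0 \<le> s" "s < t"
  shows "relative_defect s < relative_defect t"
proof -
  have "s * defect s * sine_prod s \<le> s * defect s * sine_prod t"
    using assms sine_prod_mono[of s t] defect_nonneg[of s] by (intro mult_left_mono) auto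
  also have "\<dots> < t * defect t * sine_prod t"
    using assms mult_defect_mono[of s t] sine_prod_ge_1[of t] by (intro mult_strict_right_mono) auto
  finally show ?thesis by (simp add: relative_defect_def)
qed

lemma convex_on_relative_defect: "convex_on {0..} relative_defect"
proof -
  have "mono_on {0..} (\<lambda>t. t * defect t)"
    using mult_defect_mono by (auto simp: monotone_on_def le_less)
  moreover have "mono_on {0..} sine_prod"
    using sine_prod_mono by (auto simp: monotone_on_def)
  moreover have "(\<lambda>t. t * defect t) \<in> {0..} \<rightarrow> {0..}"
    using defect_nonneg by auto
  moreover have "sine_prod \<in> {0..} \<rightarrow> {0..}"
    using sine_prod_ge_1 by (auto intro: order_trans[OF zero_le_one])
  ultimately have "convex_on {0..} (\<lambda>t. (t * defect t) * sine_prod t)"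
    by (intro convex_on_mul convex_on_mult_defect convex_on_sine_prod)
  thus ?thesis
    by (simp add: relative_defect_def [abs_def])
qed

lemma relative_defect_le:
  assumes "0 \<le> t" "t \<le> 1"
  shows "relative_defect t \<le> t * relative_defect 1"
  using convex_onD[OF convex_on_relative_defect, of t 0 1] assms by simp

text \<open>\<open>G1\<close>, \<open>G2\<close>, \<open>G3\<close> are \<open>F\<^sub>1\<close>,
  \<open>F\<^sub>2\<close>, \<open>F\<^sub>3\<close> as functions of t = x (1 - x), extended to all
  t \<ge> 0. Values beyond 1/4 enter the proof that concavity in x fails.\<close>

definition G1 :: "real \<Rightarrow> real" where "G1 t = (1 + t) * (1 - relative_defect t)"
definition G2 :: "real \<Rightarrow> real" where "G2 t = 1 - relative_defect t - 1 / (1 + t)"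
definition G3 :: "real \<Rightarrow> real" where "G3 t = inverse (1 + t) * inverse (sine_prod t) - defect t"

text \<open>Strictness comes from multiplying by 1 + t: an increasing affine factor times a
  decreasing one leaves the surplus u (1 - u) (b - a) (g b - g a), positive since g is strictly
  increasing.\<close>

lemma strict_concave_on_G1: "strict_concave_on {0..} G1"
  unfolding strict_concave_on_def
proof (intro ballI impI)
  fix a b u :: real
  assume *: "a \<in> {0..}" "b \<in> {0..}" "u \<in> {0<..<1}" "a < b"
  define z where "z = (1 - u) * a + u * b"
  define g where "g = relative_defect"
  have "g z \<le> (1 - u) * g a + u * g b"
    using * convex_onD[OF convex_on_relative_defect, of u a b] by (simp add: z_def g_def)
  moreover have "1 + z > 0"
    using * by (auto simp: z_def intro!: add_pos_nonneg)
  ultimately have "(1 + z) * (1 - ((1 - u) * g a + u * g b)) \<le> (1 + z) * (1 - g z)"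
    by (intro mult_left_mono) auto
  moreover have "u * (1 - u) * ((b - a) * (g b - g a)) > 0"
    using * relative_defect_strict_mono[of a b] by (simp add: g_def)
  moreover have "(1 + z) * (1 - ((1 - u) * g a + u * g b)) =
     (1 - u) * ((1 + a) * (1 - g a)) + u * ((1 + b) * (1 - g b)) + u * (1 - u) * ((b - a) * (g b - g a))"
    by (simp add: z_def algebra_simps)
  ultimately show "(1 - u) * G1 a + u * G1 b < G1 ((1 - u) * a + u * b)"
    unfolding z_def [symmetric] G1_def g_def by linarith
qed

text \<open>Here strictness comes from 1 / (1 + t), whose gap below its chord is computed
  exactly.\<close>

lemma strict_concave_on_G2: "strict_concave_on {0..} G2"
  unfolding strict_concave_on_def
proof (intro ballI impI)
  fix a b u :: real
  assume *: "a \<in> {0..}" "b \<in> {0..}" "u \<in> {0<..<1}" "a < b"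
  define z where "z = (1 - u) * a + u * b"
  define g where "g = relative_defect"
  have "g z \<le> (1 - u) * g a + u * g b"
    using * convex_onD[OF convex_on_relative_defect, of u a b] by (simp add: z_def g_def)
  moreover have z: "1 + z > 0"
    using * by (auto simp: z_def intro!: add_pos_nonneg)
  moreover have "(1 - u) * (1 / (1 + a)) + u * (1 / (1 + b)) - 1 / (1 + z)
      = u * (1 - u) * (b - a)\<^sup>2 / ((1 + a) * (1 + b) * (1 + z))"
    using * z by (simp add: divide_simps) (simp add: z_def algebra_simps power2_eq_square)
  moreover have "u * (1 - u) * (b - a)\<^sup>2 / ((1 + a) * (1 + b) * (1 + z)) > 0"
    using * z by simp
  ultimately show "(1 - u) * G2 a + u * G2 b < G2 ((1 - u) * a + u * b)"
    unfolding z_def [symmetric] G2_def g_def [symmetric] by (simp add: algebra_simps)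
qed

lemma R_div_B:
  assumes "x \<in> {0<..1/2}"
  shows "R x / B x = 1 - relative_defect (x * (1 - x))"
proof -
  define t where "t = x * (1 - x)"
  have t: "t > 0" using times_one_minus_bounds[OF assms] by (simp add: t_def)
  have P: "sine_prod t > 0" using sine_prod_ge_1[of t] t by simp
  have B: "B x = 1 / (t * sine_prod t)" and R: "R x = B x - defect t"
    using assms R_eq_B_minus_defect[of x] B_eq_sine_prod[of x] by (simp_all add: t_def)
  show ?thesis
    unfolding R t_def [symmetric] unfolding B using t P
    by (simp add: relative_defect_def field_simps)
qed

lemma F1_eq: "x \<in> {0<..1/2} \<Longrightarrow> F\<^sub>1 x = G1 (x * (1 - x))"
  by (simp add: F\<^sub>1_def G1_def R_div_B)

lemma F2_eq: "x \<in> {0<..1/2} \<Longrightarrow> F\<^sub>2 x = G2 (x * (1 - x))"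
  by (simp add: F\<^sub>2_def G2_def R_div_B)

lemma F3_eq:
  assumes "x \<in> {0<..1/2}" 
  shows "F\<^sub>3 x = G3 (x * (1 - x))"
proof -
  define t where "t = x * (1 - x)"
  have t: "t > 0" using times_one_minus_bounds[OF assms] by (simp add: t_def)
  have P: "sine_prod t > 0" using sine_prod_ge_1[of t] t by simp
  have "1 / (t * sine_prod t) - 1 / (t * sine_prod t) / (1 + t) = inverse (1 + t) * inverse (sine_prod t)"
    using t P by (simp add: divide_simps)
  thus ?thesis
    using assms R_eq_B_minus_defect[of x] B_eq_sine_prod[of x]
    by (simp add: F\<^sub>3_def G3_def t_def [symmetric])
qed

subsection \<open>Numerical bounds near the peak\<close>

text \<open>
  The maximum of \<open>F\<^sub>1\<close> is \<open>1.1121449\<dots>\<close>, attained near \<open>t = 1 / 5\<close>, so the margin is about \<open>1 / 10\<^sup>6\<close>.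
  Below, the two terms \<open>3 t / (2 + t)\<close> and \<open>7 t / (6 (12 + t))\<close> of the defect are kept exactly, the
  concave remainder is replaced by its chord over \<open>[3 / 16, 1 / 4]\<close>, and \<open>t P = cos \<surd>Y / \<pi>\<close> with
  \<open>Y = \<pi>\<^sup>2 (1 / 4 - t)\<close> by a Taylor polynomial, with \<open>9.8697 > \<pi>\<^sup>2\<close> and \<open>0.3183098 < 1 / \<pi>\<close>.
  Denominators are cleared. The coefficients \<open>h\<^sub>i\<close> and \<open>e\<^sub>i\<close> are those of the expansions in \<open>z = t - 1 / 5\<close>.
\<close>

lemma G1_bound_polynomial:
  fixes t :: real
  assumes "3 / 16 < t" "t < 1 / 4"
  defines "Y \<equiv> 9.8697 * (1 / 4 - t)"
  shows "(t - 0.112146) * ((2 + t) * (12 + t)) <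
     (1 + t) * (3 * t * (12 + t) + 7 / 6 * t * (2 + t) +
      16 * ((1 / 4 - t) * 0.008908 + (t - 3 / 16) * 0.011861) * ((2 + t) * (12 + t))) *
      ((1 - Y / 2 + Y^2 / 24 - Y^3 / 720) * 0.3183098)"
proof -
  define z where "z = t - 1 / 5"
  have t: "t = 1 / 5 + z" by (simp add: z_def)
  define h0 h1 h2 h3 h4 :: real where "h0 = 3033103409 / 312500000" and "h1 = 21665315681 / 375000000" and "h2 = 590409499 / 12500000" and "h3 = 73698511 / 15000000" and "h4 = 2953 / 62500"
  define e0 e1 e2 e3 :: real where "e0 = 777427188509459835925747 / 3200000000000000000000000" and "e1 = 231168580166564586222759 / 160000000000000000000000" and "e2 = 9825575493691319777241 / 8000000000000000000000" and "e3 = 170015830284258074253 / 400000000000000000000"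
  have H: "(1 + t) * (3 * t * (12 + t) + 7 / 6 * t * (2 + t) +
      16 * ((1 / 4 - t) * 0.008908 + (t - 3 / 16) * 0.011861) * ((2 + t) * (12 + t)))
    = h0 + z * (h1 + z * (h2 + z * (h3 + z * h4)))"
    unfolding t h0_def h1_def h2_def h3_def h4_def by (simp add: field_simps)
  have E: "(1 - Y / 2 + Y^2 / 24 - Y^3 / 720) * 0.3183098 = e0 + z * (e1 + z * (e2 + z * e3))"
    unfolding Y_def t e0_def e1_def e2_def e3_def by (simp add: field_simps power2_eq_square power3_eq_cube)
  have R: "(t - 0.112146) * ((2 + t) * (12 + t)) = 29475017 / 12500000 + z * (8782843 / 312500 + z * (7243927 / 500000 + z * (1 / 1)))"
    unfolding t by (simp add: field_simps)
  \<comment> \<open>Coefficients of z^2 to z^7 in the difference of the two sides; \<open>c\<close>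
    and \<open>q\<close> below are those of degree 0 and 1.\<close>
  define a2 a3 a4 a5 a6 a7 where "a2 = h0 * e2 + h1 * e1 + h2 * e0 - 7243927 / 500000"
    and "a3 = h0 * e3 + h1 * e2 + h2 * e1 + h3 * e0 - 1" and "a4 = h1 * e3 + h2 * e2 + h3 * e1 + h4 * e0"
    and "a5 = h2 * e3 + h3 * e2 + h4 * e1" and "a6 = h3 * e3 + h4 * e2" and "a7 = h4 * e3"
  have a: "92 < a2" "\<bar>a3\<bar> < 144" "\<bar>a4\<bar> < 90" "\<bar>a5\<bar> < 27" "\<bar>a6\<bar> < 3" "\<bar>a7\<bar> < 1"
    unfolding a2_def a3_def a4_def a5_def a6_def a7_def h0_def h1_def h2_def h3_def h4_def
      e0_def e1_def e2_def e3_def by simp_all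
  have z: "\<bar>z\<bar> < 1 / 20" "- 1 / 80 < z"
    unfolding z_def using assms(1,2) by linarith+
  \<comment> \<open>One Horner step with |z| < 1/20. Iterated, it shows that the terms of degree at
    least 3 lower the quadratic coefficient by at most 8, from above 92 to above 80.\<close>
  have step: "\<bar>a + z * i\<bar> < c + d / 20" if "\<bar>a\<bar> < c" "\<bar>i\<bar> < d" for a i c d
  proof -
    have "\<bar>z\<bar> * \<bar>i\<bar> \<le> 1 / 20 * d"
      using z that by (intro mult_mono) auto
    thus ?thesis
      using that abs_triangle_ineq[of a "z * i"] by (simp add: abs_mult)
  qed
  define q where "q = h0 * e1 + h1 * e0 - 8782843 / 312500"
  define i3 where "i3 = a3 + z * (a4 + z * (a5 + z * (a6 + z * a7)))"
  have "\<bar>i3\<bar> < 144 + (90 + (27 + (3 + 1 / 20) / 20) / 20) / 20"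
    unfolding i3_def by (intro step a)
  hence "\<bar>z\<bar> * \<bar>i3\<bar> \<le> 1 / 20 * 160"
    using z by (intro mult_mono) auto
  hence "80 \<le> a2 + z * i3"
    using a(1) by (simp flip: abs_mult)
  \<comment> \<open>What remains is c + q z + 80 z^2 > 0. Completing the square costs q^2 / 320,
    which is below 0.000007 and hence below c.\<close>
  define m c where "m = z\<^sup>2 * (a2 + z * i3)" and "c = h0 * e0 - 29475017 / 12500000"
  have "z\<^sup>2 * 80 \<le> m"
    unfolding m_def using \<open>80 \<le> a2 + z * i3\<close> by (intro mult_left_mono) auto
  moreover have "0.000015 < c"
    unfolding c_def h0_def e0_def by simp
  moreover have "\<bar>q\<bar> \<le> 0.046"
    unfolding q_def h0_def e0_def h1_def e1_def by simp
  hence "q\<^sup>2 \<le> 0.046 * 0.046"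
    unfolding power2_eq_square abs_mult_self_eq [symmetric, of q] by (intro mult_mono) auto
  moreover have "80 * (z + q / 160)\<^sup>2 = z\<^sup>2 * 80 + z * q + q\<^sup>2 / 320"
    by (simp add: power2_eq_square field_simps)
  moreover have "80 * (z + q / 160)\<^sup>2 \<ge> 0"
    by simp
  ultimately have "0 < c + z * q + m"
    by simp
  moreover have "(h0 + z * (h1 + z * (h2 + z * (h3 + z * h4)))) * (e0 + z * (e1 + z * (e2 + z * e3))) =
     29475017 / 12500000 + z * (8782843 / 312500 + z * (7243927 / 500000 + z)) + (c + z * q + m)"
    unfolding c_def m_def q_def i3_def a2_def a3_def a4_def a5_def a6_def a7_def
    by (simp add: algebra_simps power2_eq_square)
  ultimately show ?thesis
    unfolding H E R by simp
qed

section \<open>Closed forms at 1/4 and 1/2, and bounds for the constants\<close>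

lemma ln2_bounds: "0.693147180559 < ln (2::real)" "ln (2::real) < 0.693147180561"
  using ln_approx_bounds[of 2 12] by (simp_all add: eval_nat_numeral)

lemma sqrt2_bounds: "1.41421356237 < sqrt 2" "sqrt 2 < 1.41421356238"
  by (rule real_less_rsqrt real_less_lsqrt; simp add: power2_eq_square)+

lemma Digamma_half_real: "Digamma (1 / 2 :: real) = - euler_mascheroni - 2 * ln 2"
  using Digamma_one_half[where 'a = real] by simp

lemma R_half: "R (1 / 2) = 4 * ln 2"
  by (simp add: R_def Digamma_half_real)

text \<open>Duplication at 1/4 delivers \<open>Digamma (1 / 4) + Digamma (3 / 4)\<close> as one sum,
  which is what R contains.\<close>

lemma R_quarter: "R (1 / 4) = 6 * ln 2"
  using Digamma_duplication[of "1 / 4"] by (simp add: R_def Digamma_half_real)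

lemma B_half: "B (1 / 2) = pi"
  by (simp add: B_eq_sin)

lemma B_quarter: "B (1 / 4) = pi * sqrt 2"
  by (simp add: B_eq_sin sin_45 field_simps)

lemma defect_quarter: "defect (1 / 4) = pi - 4 * ln 2"
  using R_eq_B_minus_defect[of "1 / 2"] by (simp add: R_half B_half)

lemma defect_three_sixteenths: "defect (3 / 16) = pi * sqrt 2 - 6 * ln 2"
  using R_eq_B_minus_defect[of "1 / 4"] by (simp add: R_quarter B_quarter)

text \<open>The Maclaurin remainders of order 6 and 8 are -cos a y^6 / 6! and cos b y^8 / 8! with a,
  b in (0, y), where cosine is nonnegative.\<close>

lemma cos_Taylor_bounds:
  fixes y :: real
  assumes "0 \<le> y" "y \<le> pi / 2"
  shows "1 - y^2 / 2 + y^4 / 24 - y^6 / 720 \<le> cos y" "cos y \<le> 1 - y^2 / 2 + y^4 / 24"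
proof -
  have "1 - y^2 / 2 + y^4 / 24 - y^6 / 720 \<le> cos y \<and> cos y \<le> 1 - y^2 / 2 + y^4 / 24"
  proof (cases "y = 0")
    case False
    hence y: "0 < y" using assms by simp
    have shift: "cos (a + 1 / 2 * real 6 * pi) = - cos a" "cos (a + 1 / 2 * real 8 * pi) = cos a" for a :: real
    proof -
      have "cos (a + 1 / 2 * real 6 * pi) = cos ((a + pi) + 2 * pi)"
        by (rule arg_cong[of _ _ cos]) simp
      thus "cos (a + 1 / 2 * real 6 * pi) = - cos a"
        by (simp only: cos_periodic cos_periodic_pi)
      have "cos (a + 1 / 2 * real 8 * pi) = cos ((a + 2 * pi) + 2 * pi)"
        by (rule arg_cong[of _ _ cos]) simp
      thus "cos (a + 1 / 2 * real 8 * pi) = cos a"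
        by (simp only: cos_periodic)
    qed
    obtain a where a: "0 < a" "a < y"
      "cos y = (\<Sum>m<6. cos_coeff m * y ^ m) + cos (a + 1 / 2 * real 6 * pi) / fact 6 * y ^ 6"
      using Maclaurin_cos_expansion2[OF y, of 6] by auto
    obtain b where b: "0 < b" "b < y"
      "cos y = (\<Sum>m<8. cos_coeff m * y ^ m) + cos (b + 1 / 2 * real 8 * pi) / fact 8 * y ^ 8"
      using Maclaurin_cos_expansion2[OF y, of 8] by auto
    have "cos a \<ge> 0" "cos b \<ge> 0"
      using a b assms by (auto intro!: cos_ge_zero)
    hence "cos a / fact 6 * y ^ 6 \<ge> 0" "cos b / fact 8 * y ^ 8 \<ge> 0"
      using y by auto
    moreover have "(\<Sum>m<6. f m) = f 0 + f 1 + f 2 + f 3 + f 4 + f 5"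
      "(\<Sum>m<8. f m) = f 0 + f 1 + f 2 + f 3 + f 4 + f 5 + f 6 + f 7" for f :: "nat \<Rightarrow> real"
      by (simp_all add: eval_nat_numeral)
    hence "(\<Sum>m<6. cos_coeff m * y ^ m) = 1 - y^2 / 2 + y^4 / 24"
      "(\<Sum>m<8. cos_coeff m * y ^ m) = 1 - y^2 / 2 + y^4 / 24 - y^6 / 720"
      by (simp_all add: cos_coeff_def fact_numeral)
    ultimately show ?thesis
      using a(3) b(3) unfolding shift by simp
  qed auto
  thus "1 - y^2 / 2 + y^4 / 24 - y^6 / 720 \<le> cos y" "cos y \<le> 1 - y^2 / 2 + y^4 / 24"
    by auto
qed

text \<open>By the two formulas for B, t times the product equals sin (pi x) / pi = cos y / pi with
  y = pi (1/2 - x). Since y^2 = pi^2 (1/4 - t), the even Taylor polynomials in y are polynomials in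
  t.\<close>

lemma mult_sine_prod_bounds:
  fixes t :: real
  assumes "0 < t" "t \<le> 1 / 4"
  defines "Y \<equiv> pi\<^sup>2 * (1 / 4 - t)"
  shows "(1 - Y / 2 + Y^2 / 24 - Y^3 / 720) / pi \<le> t * sine_prod t"
    and "t * sine_prod t \<le> (1 - Y / 2 + Y^2 / 24) / pi"
proof -
  obtain x where x: "x \<in> {0<..1/2}" "x * (1 - x) = t"
    using times_one_minus_preimage assms by blast
  define y where "y = pi * (1 / 2 - x)"
  have y: "0 \<le> y" "y \<le> pi / 2"
    using x by (auto simp: y_def intro: mult_nonneg_nonneg)
  have Y: "Y = y\<^sup>2"
    by (simp add: Y_def y_def x(2) [symmetric] power2_eq_square field_simps)
  have "sin (pi * x) = cos (pi / 2 - pi * x)"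
    by (simp add: cos_diff)
  also have "pi / 2 - pi * x = y"
    by (simp add: y_def algebra_simps)
  finally have "pi / cos y = 1 / (t * sine_prod t)"
    using x B_eq_sine_prod[of x] B_eq_sin[of x] by simp
  moreover have "pi * x > 0" "y = pi / 2 - pi * x"
    using x by (simp_all add: y_def algebra_simps)
  hence "cos y > 0"
    using y by (intro cos_gt_zero_pi) auto
  hence "cos y \<noteq> 0" by simp
  moreover have "t * sine_prod t \<noteq> 0"
    using assms sine_prod_ge_1[of t] by simp
  ultimately have "pi * (t * sine_prod t) = 1 * cos y"
    using frac_eq_eq[of "cos y" "t * sine_prod t" pi 1] by blast
  hence "t * sine_prod t = cos y / pi"
    by (metis mult_1 nonzero_mult_div_cancel_left pi_neq_zero)
  thus "(1 - Y / 2 + Y^2 / 24 - Y^3 / 720) / pi \<le> t * sine_prod t"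
    "t * sine_prod t \<le> (1 - Y / 2 + Y^2 / 24) / pi"
    using cos_Taylor_bounds[OF y] by (auto simp: Y divide_right_mono simp flip: power_mult)
qed

text \<open>The subtracted fractions are \<open>defect_term 0\<close> and
  \<open>defect_term 1\<close>, so only a small concave remainder has to be estimated by
  chords.\<close>

definition defect_tail :: "real \<Rightarrow> real" where
  "defect_tail t = defect t - 3 * t / (2 + t) - 7 / 6 * t / (12 + t)"

lemma concave_on_defect_tail: "concave_on {0..} defect_tail"
proof -
  have "defect_term 0 t = 3 * t / (2 + t)" "defect_term 1 t = 7 / 6 * t / (12 + t)" if "t \<ge> 0" for t
    using that by (simp_all add: defect_term_def divide_simps)
  hence eq: "- (defect t - (\<Sum>k<2. defect_term k t)) = - defect_tail t" if "t \<in> {0..}" for t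
    using that by (simp add: defect_tail_def eval_nat_numeral)
  show ?thesis
    unfolding concave_on_def
    by (rule convex_on_cong[OF concave_on_defect_remainder[of 2, unfolded concave_on_def] eq])
qed

lemma pi_sqrt2_bounds: "4.4428829381 < pi * sqrt 2" "pi * sqrt 2 < 4.4428829383"
proof -
  have "4.4428829381 < 3.141592653588 * (1.41421356237 :: real)" by simp
  also have "\<dots> < pi * sqrt 2"
    using pi_approx sqrt2_bounds by (intro mult_le_less_imp_less) auto
  finally show "4.4428829381 < pi * sqrt 2" .
  have "pi * sqrt 2 < 3.1415926535899 * 1.41421356238"
    using pi_approx sqrt2_bounds by (intro mult_le_less_imp_less) auto
  also have "\<dots> < (4.4428829383 :: real)" by simp
  finally show "pi * sqrt 2 < 4.4428829383" .
qed

text \<open>The nodes 3/16 and 1/4 are the values of x (1 - x) at x = 1/4 and x = 1/2, where R and B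
  have closed forms.\<close>

lemma defect_tail_bounds:
  "0.008908 < defect_tail (3 / 16)" "defect_tail (3 / 16) < 0.008909" "0.011861 < defect_tail (1 / 4)"
proof -
  have "defect_tail (3 / 16) = pi * sqrt 2 - 6 * ln 2 - 9 / 35 - 7 / 390"
    by (simp add: defect_tail_def defect_three_sixteenths)
  thus "0.008908 < defect_tail (3 / 16)" "defect_tail (3 / 16) < 0.008909"
    using pi_sqrt2_bounds ln2_bounds by simp_all
  have "defect_tail (1 / 4) = pi - 4 * ln 2 - 1 / 3 - 1 / 42"
    by (simp add: defect_tail_def defect_quarter)
  thus "0.011861 < defect_tail (1 / 4)"
    using pi_approx ln2_bounds by simp
qed

lemma pi_squared_bounds: "9.8696 < pi\<^sup>2" "pi\<^sup>2 < 9.8697"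
proof -
  have "3.141592 ^ 2 < pi\<^sup>2" "pi\<^sup>2 < 3.1415927 ^ 2"
    using pi_approx by (intro power_strict_mono; simp)+
  thus "9.8696 < pi\<^sup>2" "pi\<^sup>2 < 9.8697" by (simp_all add: power2_eq_square)
qed

lemma G1_less:
  assumes t: "3 / 16 < t" "t < 1 / 4"
  shows "G1 t < 1.112146"
proof -
  define Y C where "Y = pi\<^sup>2 * (1 / 4 - t)" and "C = (\<lambda>Y::real. 1 - Y / 2 + Y^2 / 24 - Y^3 / 720)"
  define Y' where "Y' = 9.8697 * (1 / 4 - t)"
  define w where "w = 3 * t / (2 + t) + 7 / 6 * t / (12 + t) +
     16 * ((1 / 4 - t) * 0.008908 + (t - 3 / 16) * 0.011861)"
  define D where "D = (2 + t) * (12 + t)"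
  have D: "D > 0" using t by (simp add: D_def)
  have Y: "0 \<le> Y" "Y \<le> Y'" "Y' \<le> 1"
    using t pi_squared_bounds mult_right_mono[of "pi\<^sup>2" "9.8697" "1 / 4 - t"] by (auto simp: Y_def Y'_def)
  \<comment> \<open>The cosine polynomial decreases on [0, 1], so replacing pi^2 by the larger
    9.8697 keeps it a lower bound.\<close>
  have "C Y' \<le> C Y"
  proof -
    have "(Y' - Y) * (1 / 2 - (Y + Y') / 24 + (Y^2 + Y * Y' + Y'^2) / 720) \<ge> 0"
      using Y by (intro mult_nonneg_nonneg add_nonneg_nonneg) auto
    moreover have "C Y - C Y' = (Y' - Y) * (1 / 2 - (Y + Y') / 24 + (Y^2 + Y * Y' + Y'^2) / 720)"
      by (simp add: C_def field_simps power2_eq_square power3_eq_cube)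
    ultimately show ?thesis by simp
  qed
  moreover have "C Y' \<ge> 0"
  proof -
    have "Y' ^ 3 \<le> 1" "0 \<le> Y'\<^sup>2"
      using Y by (auto intro: power_le_one)
    thus ?thesis
      unfolding C_def using Y by linarith
  qed
  moreover have "0.3183098 \<le> 1 / pi"
    using pi_approx by (simp add: field_simps)
  ultimately have "C Y' * 0.3183098 \<le> C Y * (1 / pi)"
    by (intro mult_mono) auto
  also have "\<dots> \<le> t * sine_prod t"
    using mult_sine_prod_bounds(1)[of t] t by (simp add: Y_def C_def)
  finally have S: "C Y' * 0.3183098 \<le> t * sine_prod t" .
  \<comment> \<open>A concave tail lies above its chord over [3/16, 1/4]; the weight is 16 (t -
    3/16) because the interval has length 1/16.\<close>
  have "(1 - 16 * (t - 3 / 16)) * defect_tail (3 / 16) + 16 * (t - 3 / 16) * defect_tail (1 / 4)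
     \<le> defect_tail ((1 - 16 * (t - 3 / 16)) *\<^sub>R (3 / 16) + (16 * (t - 3 / 16)) *\<^sub>R (1 / 4))"
    using t by (intro concave_onD[OF concave_on_defect_tail]) auto
  also have "(1 - 16 * (t - 3 / 16)) *\<^sub>R (3 / 16) + (16 * (t - 3 / 16)) *\<^sub>R (1 / 4) = t"
    by (simp add: algebra_simps)
  also have "(1 - 16 * (t - 3 / 16)) * defect_tail (3 / 16) = 16 * (1 / 4 - t) * defect_tail (3 / 16)"
    by (simp add: algebra_simps)
  also have "16 * (1 / 4 - t) * 0.008908 + 16 * (t - 3 / 16) * 0.011861 \<le>
      16 * (1 / 4 - t) * defect_tail (3 / 16) + 16 * (t - 3 / 16) * defect_tail (1 / 4)"
    using t defect_tail_bounds by (intro add_mono mult_left_mono) auto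
  finally have w: "w \<le> defect t" 
    by (simp add: w_def defect_tail_def)
  have "0 \<le> w"
    using t by (auto simp: w_def intro!: add_nonneg_nonneg)
  hence "w * (C Y' * 0.3183098) \<le> defect t * (t * sine_prod t)"
    using w \<open>C Y' \<ge> 0\<close> by (intro mult_mono[OF w S]) auto
  hence "G1 t \<le> (1 + t) * (1 - w * (C Y' * 0.3183098))"
    unfolding G1_def using t by (intro mult_left_mono) (auto simp: relative_defect_def mult_ac)
  also have "\<dots> < 1.112146"
  proof -
    define N where "N = 3 * t * (12 + t) + 7 / 6 * t * (2 + t) +
      16 * ((1 / 4 - t) * 0.008908 + (t - 3 / 16) * 0.011861) * D"
    have N: "w * D = N"
    proof -
      have "a / (2 + t) * D = a * (12 + t)" "a / (12 + t) * D = a * (2 + t)" for a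
        using t by (simp_all add: D_def)
      thus ?thesis
        unfolding w_def N_def by (simp only: distrib_right)
    qed
    have "(t - 0.112146) * D < (1 + t) * N * (C Y' * 0.3183098)"
      using G1_bound_polynomial[OF t] unfolding N_def D_def C_def Y'_def .
    moreover have "(1 + t) * (D - N * (C Y' * 0.3183098)) =
        D * 1.112146 + (t - 0.112146) * D - (1 + t) * N * (C Y' * 0.3183098)"
      by (simp add: algebra_simps)
    ultimately have "(1 + t) * (D - N * (C Y' * 0.3183098)) < D * 1.112146"
      by linarith
    also have "(1 + t) * (D - N * (C Y' * 0.3183098)) = D * ((1 + t) * (1 - w * (C Y' * 0.3183098)))"
      unfolding N [symmetric] by (simp add: algebra_simps)
    finally have "D * ((1 + t) * (1 - w * (C Y' * 0.3183098))) < D * 1.112146" .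
    thus ?thesis using D by (simp only: mult_less_cancel_left_pos)
  qed
  finally show ?thesis .
qed

text \<open>A witness near the peak. The threshold 1.111593 is an upper bound for
  \<open>F\<^sub>1 (1 / 4)\<close>, that is, for G1 at 3/16, so the peak in t is forced to the right
  of 3/16.\<close>

lemma G1_near_peak: "1.111593 < G1 0.2016"
proof -
  define t :: real where "t = 0.2016"
  define u :: real where "u = 3 / 16 / t"
  define Y C where "Y = pi\<^sup>2 * (1 / 4 - t)" and "C = 1 - Y / 2 + Y^2 / 24"
  \<comment> \<open>An upper bound at t needs extrapolation: 3/16 = u t lies between 0 and t and the
    tail vanishes at 0, so concavity bounds the tail at t by its value at 3/16 divided by u.\<close>
  have "(1 - u) * defect_tail 0 + u * defect_tail t \<le> defect_tail ((1 - u) *\<^sub>R 0 + u *\<^sub>R t)"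
    by (intro concave_onD[OF concave_on_defect_tail]) (auto simp: u_def t_def)
  hence "defect_tail t \<le> defect_tail (3 / 16) / u"
    by (simp add: u_def t_def defect_tail_def)
  also have "\<dots> \<le> 0.008909 / u"
    using defect_tail_bounds by (intro divide_right_mono) (auto simp: u_def t_def)
  finally have w: "defect t \<le> 0.303565"
    by (simp add: defect_tail_def u_def t_def)
  have Y: "0.4776 < Y" "Y < 0.47770"
    using pi_squared_bounds by (auto simp: Y_def t_def)
  hence "Y * Y \<le> 0.4777 * 0.4777"
    by (intro mult_mono) auto
  hence "C \<le> 0.770709"
    using Y by (simp add: C_def power2_eq_square)
  have "t * sine_prod t \<le> C / pi"
    unfolding C_def Y_def by (rule mult_sine_prod_bounds) (simp_all add: t_def)
  also have "\<dots> \<le> 0.770709 / 3.141592"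
    using pi_approx \<open>C \<le> 0.770709\<close> by (intro frac_le) auto
  finally have S: "t * sine_prod t \<le> 0.2453246"
    by simp
  have "defect t * (t * sine_prod t) \<le> 0.303565 * 0.2453246"
    using w S sine_prod_ge_1[of t] by (intro mult_mono) (auto simp: t_def)
  hence "relative_defect t \<le> 0.303565 * 0.2453246"
    by (simp add: relative_defect_def mult_ac)
  thus ?thesis
    by (simp add: G1_def t_def)
qed

subsection \<open>Values and limits of the three functions\<close>

lemma F1_half: "F\<^sub>1 (1 / 2) = 5 * ln 2 / pi"
  by (simp add: F\<^sub>1_def R_half B_half)

lemma F1_half_bounds: "1.103178 \<le> F\<^sub>1 (1 / 2)" "F\<^sub>1 (1 / 2) < 1.103179"
proof -
  have "1.103178 * pi \<le> 5 * ln 2" "5 * ln 2 < 1.103179 * pi"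
    using pi_approx ln2_bounds by (simp_all add: field_simps)
  thus "1.103178 \<le> F\<^sub>1 (1 / 2)" "F\<^sub>1 (1 / 2) < 1.103179"
    by (simp_all only: F1_half pos_le_divide_eq pos_divide_less_eq pi_gt_zero)
qed

lemma ln_8: "ln (8 :: real) = 3 * ln 2"
  using ln_realpow[of 2 3] by simp

lemma F1_quarter: "F\<^sub>1 (1 / 4) = 19 * sqrt 2 * ln 8 / (16 * pi)"
proof -
  have "6 / sqrt 2 = 3 * sqrt 2"
    by (simp add: real_div_sqrt field_simps)
  thus ?thesis
    by (simp add: F\<^sub>1_def R_quarter B_quarter ln_8 field_simps)
qed

lemma F1_quarter_bounds: "1.111592 \<le> F\<^sub>1 (1 / 4)" "F\<^sub>1 (1 / 4) < 1.111593"
proof -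
  have "1.41421356237 * 0.693147180559 \<le> sqrt 2 * ln 2"
    using sqrt2_bounds ln2_bounds by (intro mult_mono) auto
  moreover have "sqrt 2 * ln 2 \<le> 1.41421356238 * 0.693147180561"
    using sqrt2_bounds ln2_bounds by (intro mult_mono) auto
  ultimately have "1.111592 * (16 * pi) \<le> 19 * sqrt 2 * ln 8" "19 * sqrt 2 * ln 8 < 1.111593 * (16 * pi)"
    using pi_approx unfolding ln_8 by (simp_all add: field_simps)
  thus "1.111592 \<le> F\<^sub>1 (1 / 4)" "F\<^sub>1 (1 / 4) < 1.111593"
    by (simp_all only: F1_quarter pos_le_divide_eq pos_divide_less_eq pi_gt_zero mult_pos_pos zero_less_numeral)
qed

lemma F2_eq_F1:
  assumes "x \<in> {0<..1/2}"
  shows "F\<^sub>2 x = (F\<^sub>1 x - 1) / (1 + x * (1 - x))"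
proof -
  have "1 + x * (1 - x) \<noteq> 0"
    using times_one_minus_bounds[OF assms] by linarith
  thus ?thesis
    unfolding F\<^sub>1_def F\<^sub>2_def diff_divide_distrib by (metis nonzero_mult_div_cancel_left)
qed

lemma F2_half: "F\<^sub>2 (1 / 2) = 4 * b\<^sub>0 / (5 * pi)"
  by (simp add: F2_eq_F1 F1_half b\<^sub>0_def field_simps)

lemma F2_half_bounds: "0.082542 \<le> F\<^sub>2 (1 / 2)" "F\<^sub>2 (1 / 2) < 0.082543"
proof -
  have "0.082542 * (5 * pi) \<le> 4 * b\<^sub>0" "4 * b\<^sub>0 < 0.082543 * (5 * pi)"
    using pi_approx ln2_bounds by (simp_all add: b\<^sub>0_def field_simps)
  thus "0.082542 \<le> F\<^sub>2 (1 / 2)" "F\<^sub>2 (1 / 2) < 0.082543"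
    by (simp_all only: F2_half pos_le_divide_eq pos_divide_less_eq pi_gt_zero mult_pos_pos zero_less_numeral)
qed

lemma F2_quarter_gt: "0.09 < F\<^sub>2 (1 / 4)"
  using F1_quarter_bounds by (simp add: F2_eq_F1)

lemma G1_at: "G1 0 = 1" "G1 (3 / 16) = F\<^sub>1 (1 / 4)" "G1 (1 / 4) = F\<^sub>1 (1 / 2)"
  using F1_eq[of "1 / 4"] F1_eq[of "1 / 2"] by (simp_all add: G1_def)

lemma G2_at: "G2 (3 / 16) = F\<^sub>2 (1 / 4)" "G2 (1 / 4) = F\<^sub>2 (1 / 2)"
  using F2_eq[of "1 / 4"] F2_eq[of "1 / 2"] by simp_all

section \<open>Location of the peaks of \<open>F\<^sub>1\<close> and
  \<open>F\<^sub>2\<close>\<close>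

lemma F1_unimodal:
  obtains x where "x \<in> {1/4<..<1/2}" "strict_mono_on {0<..x} F\<^sub>1" "strict_antimono_on {x..1/2} F\<^sub>1"
proof -
  \<comment> \<open>The left end 3/16 is x (1 - x) at x = 1/4, so a peak beyond it in t means a peak
    beyond 1/4 in x.\<close>
  have "G1 (3 / 16) < G1 0.2016" "G1 (1 / 4) < G1 0.2016"
    using G1_near_peak F1_quarter_bounds F1_half_bounds by (simp_all add: G1_at)
  then obtain t where t: "3 / 16 < t" "t < 1 / 4" "strict_mono_on {0..t} G1" "strict_antimono_on {t..} G1"
    by (rule strict_concave_unimodal[OF strict_concave_on_G1, rotated 3]) auto
  obtain x where x: "x \<in> {0<..<1/2}" "x * (1 - x) = t" "strict_mono_on {0<..x} F\<^sub>1" "strict_antimono_on {x..1/2} F\<^sub>1"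
    using unimodal_comp_times_one_minus[of F\<^sub>1 G1, OF F1_eq, of t] t by auto
  have "x > 1 / 4"
  proof (rule ccontr)
    assume "\<not> x > 1 / 4"
    hence "(1 / 4 - x) * (3 / 4 - x) \<ge> 0"
      by (intro mult_nonneg_nonneg) auto
    hence "x * (1 - x) \<le> 3 / 16"
      by (simp add: field_simps)
    thus False using x t by simp
  qed
  thus ?thesis using that x by auto
qed

lemma F2_unimodal:
  obtains x where "x \<in> {0<..<1/2}" "strict_mono_on {0<..x} F\<^sub>2" "strict_antimono_on {x..1/2} F\<^sub>2"
proof -
  \<comment> \<open>Any small left end works for \<open>F\<^sub>2\<close>; at 1/20 the bound is
    1/21, safely below the value at 3/16, which exceeds 0.09.\<close>
  have "G2 (1 / 20) \<le> 1 - 1 / (1 + 1 / 20)"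
    using relative_defect_nonneg[of "1 / 20"] by (simp add: G2_def)
  hence "G2 (1 / 20) < G2 (3 / 16)" "G2 (1 / 4) < G2 (3 / 16)"
    using F2_quarter_gt F2_half_bounds by (simp_all add: G2_at)
  then obtain t where t: "1 / 20 < t" "t < 1 / 4" "strict_mono_on {0..t} G2" "strict_antimono_on {t..} G2"
    by (rule strict_concave_unimodal[OF strict_concave_on_G2, rotated 3]) auto
  thus ?thesis
    using that unimodal_comp_times_one_minus[of F\<^sub>2 G2, OF F2_eq, of t] by auto
qed

section \<open>Limits at 0 from the right\<close>

lemma filterlim_times_one_minus:
  "filterlim (\<lambda>x::real. x * (1 - x)) (at_right 0) (at_right 0)"
  unfolding filterlim_at
proof
  show "((\<lambda>x::real. x * (1 - x)) \<longlongrightarrow> 0) (at_right 0)"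
    by (auto intro!: tendsto_eq_intros)
  show "\<forall>\<^sub>F x::real in at_right 0. x * (1 - x) \<in> {0<..} \<and> x * (1 - x) \<noteq> 0"
    by (rule eventually_mono[OF eventually_at_right_real[of 0 1]]) auto
qed

lemma tendsto_comp_times_one_minus:
  fixes F h :: "real \<Rightarrow> real"
  assumes "\<And>x. x \<in> {0<..1/2} \<Longrightarrow> F x = h (x * (1 - x))" and "(h \<longlongrightarrow> L) (at_right 0)"
  shows "(F \<longlongrightarrow> L) (at_right 0)"
proof (rule Lim_transform_eventually)
  show "((\<lambda>x. h (x * (1 - x))) \<longlongrightarrow> L) (at_right 0)"
    by (rule filterlim_compose[OF assms(2) filterlim_times_one_minus])
  show "\<forall>\<^sub>F x in at_right 0. h (x * (1 - x)) = F x"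
    by (rule eventually_mono[OF eventually_at_right_real[of 0 "1/2"]]) (auto simp: assms(1))
qed

lemma tendsto_at_right_0_squeeze:
  fixes f :: "real \<Rightarrow> real"
  assumes "\<And>t. 0 < t \<Longrightarrow> t < 1 \<Longrightarrow> 0 \<le> f t" "\<And>t. 0 < t \<Longrightarrow> t < 1 \<Longrightarrow> f t \<le> t * c"
  shows "(f \<longlongrightarrow> 0) (at_right 0)"
proof (rule tendsto_sandwich[of "\<lambda>_. 0" _ _ "\<lambda>t. t * c"])
  show "\<forall>\<^sub>F t in at_right 0. 0 \<le> f t" "\<forall>\<^sub>F t in at_right 0. f t \<le> t * c"
    using eventually_at_right_real[of 0 1] by (auto elim!: eventually_mono simp: assms)
  show "((\<lambda>t. t * c) \<longlongrightarrow> 0) (at_right 0)"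
    by (auto intro!: tendsto_eq_intros)
qed auto

lemma tendsto_relative_defect: "(relative_defect \<longlongrightarrow> 0) (at_right 0)"
  by (rule tendsto_at_right_0_squeeze[of _ "relative_defect 1"])
    (simp_all add: relative_defect_nonneg relative_defect_le)

lemma tendsto_F1: "(F\<^sub>1 \<longlongrightarrow> 1) (at_right 0)"
  by (rule tendsto_comp_times_one_minus[of F\<^sub>1 G1, OF F1_eq])
    (auto simp: G1_def [abs_def] intro!: tendsto_eq_intros tendsto_relative_defect)

lemma tendsto_F2: "(F\<^sub>2 \<longlongrightarrow> 0) (at_right 0)"
  by (rule tendsto_comp_times_one_minus[of F\<^sub>2 G2, OF F2_eq])
    (auto simp: G2_def [abs_def] intro!: tendsto_eq_intros tendsto_relative_defect)

lemma tendsto_sine_prod: "(sine_prod \<longlongrightarrow> 1) (at_right 0)"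
proof -
  have "((\<lambda>t. sine_prod t - 1) \<longlongrightarrow> 0) (at_right 0)"
  proof (rule tendsto_at_right_0_squeeze[of _ "sine_prod 1 - 1"])
    fix t :: real assume t: "0 < t" "t < 1"
    show "sine_prod t - 1 \<le> t * (sine_prod 1 - 1)"
      using convex_onD[OF convex_on_sine_prod, of t 0 1] t by (simp add: algebra_simps)
  qed (simp add: sine_prod_ge_1)
  thus ?thesis using LIM_zero_iff by blast
qed

text \<open>Concavity only bounds the defect from below by its chord, so the linear upper bound is
  obtained term by term: m \<ge> 2 gives m + t \<ge> 2/3 (m + 1), whence the factor 3/2.\<close>

lemma tendsto_defect: "(defect \<longlongrightarrow> 0) (at_right 0)"
proof (rule tendsto_at_right_0_squeeze[of _ "3 / 2 * defect 1"])
  fix t :: real assume t: "0 < t" "t < 1"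
  have "defect_term k t \<le> 3 / 2 * t * defect_term k 1" for k
  proof -
    define K m where "K = 2 * (4 * real k + 3)" and "m = (2 * real k + 1) * (2 * real k + 2)"
    have "m = 2 + (6 * real k + 4 * (real k)\<^sup>2)"
      by (simp add: m_def algebra_simps power2_eq_square)
    hence "m \<ge> 2" by simp
    hence "K * t / (m * (m + t)) \<le> K * t / (m * ((m + 1) * (2 / 3)))"
      using t by (intro divide_left_mono mult_left_mono) (auto simp: K_def)
    moreover have "defect_term k t = K * t / (m * (m + t))" for t
      by (simp add: defect_term_def K_def m_def)
    ultimately show ?thesis
      by (simp add: mult_ac)
  qed
  hence "defect t \<le> (\<Sum>k. 3 / 2 * t * defect_term k 1)"
    unfolding defect_def using t
    by (intro suminf_le summable_defect_term summable_mult) auto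
  also have "\<dots> = t * (3 / 2 * defect 1)"
    unfolding defect_def by (subst suminf_mult) (auto intro: summable_defect_term)
  finally show "defect t \<le> t * (3 / 2 * defect 1)" .
qed (simp add: defect_nonneg)

lemma G3_0 [simp]: "G3 0 = 1"
  by (simp add: G3_def)

lemma tendsto_F3: "(F\<^sub>3 \<longlongrightarrow> 1) (at_right 0)"
  by (rule tendsto_comp_times_one_minus[of F\<^sub>3 G3, OF F3_eq])
    (auto simp: G3_def [abs_def] intro!: tendsto_eq_intros tendsto_sine_prod tendsto_defect)

section \<open>Monotonicity, convexity and range of \<open>F\<^sub>3\<close>\<close>

lemma G3_strict_antimono:
  assumes "0 \<le> s" "s < t"
  shows "G3 t < G3 s"
proof -
  have "inverse (1 + t) * inverse (sine_prod t) \<le> inverse (1 + s) * inverse (sine_prod s)"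
    using assms sine_prod_mono[of s t] sine_prod_ge_1[of s]
    by (intro mult_mono le_imp_inverse_le) auto
  thus ?thesis
    using defect_strict_mono[OF assms] by (simp add: G3_def)
qed

lemma convex_on_G3: "convex_on {0..} G3"
proof -
  have "antimono_on {0..} (\<lambda>t::real. inverse (1 + t))"
    by (auto simp: monotone_on_def intro!: le_imp_inverse_le)
  moreover have "antimono_on {0..} (\<lambda>t. inverse (sine_prod t))"
    using sine_prod_mono sine_prod_ge_1
    by (auto simp: monotone_on_def intro!: le_imp_inverse_le) (meson less_le_trans zero_less_one)
  ultimately have "convex_on {0..} (\<lambda>t. inverse (1 + t) * inverse (sine_prod t))"
    using sine_prod_ge_1 order_trans[OF zero_le_one]
    by (intro convex_on_mul_antimono convex_on_inverse_sine_prod convex_on_inverse_shift) auto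
  thus ?thesis
    unfolding G3_def [abs_def] by (intro convex_on_diff concave_on_defect)
qed

lemma strict_antimono_F3: "strict_antimono_on {0<..1/2} F\<^sub>3"
  using times_one_minus_less times_one_minus_bounds
  by (auto simp: monotone_on_def F3_eq intro!: G3_strict_antimono)

lemma convex_on_F3: "convex_on {0<..1/2} F\<^sub>3"
proof (rule convex_onI)
  fix u x y :: real
  assume *: "0 < u" "u < 1" "x \<in> {0<..1/2}" "y \<in> {0<..1/2}"
  define z where "z = (1 - u) *\<^sub>R x + u *\<^sub>R y"
  define t where "t = (1 - u) *\<^sub>R (x * (1 - x)) + u *\<^sub>R (y * (1 - y))"
  have "convex {0<..1/2::real}" by simp
  hence z: "z \<in> {0<..1/2}"
    using * unfolding convex_alt z_def by auto
  \<comment> \<open>The exact concavity gap of x (1 - x); since G3 decreases, moving from t up to z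
    (1 - z) only lowers the value.\<close>
  have "z * (1 - z) - t = u * (1 - u) * (x - y)\<^sup>2"
    by (simp add: z_def t_def algebra_simps power2_eq_square)
  moreover have "u * (1 - u) * (x - y)\<^sup>2 \<ge> 0"
    using * by simp
  ultimately have "t \<le> z * (1 - z)" by simp
  moreover have "t \<ge> 0"
    using * by (auto simp: t_def intro!: add_nonneg_nonneg mult_nonneg_nonneg)
  ultimately have "G3 (z * (1 - z)) \<le> G3 t"
    using G3_strict_antimono[of t "z * (1 - z)"] by (cases "t = z * (1 - z)") auto
  also have "\<dots> \<le> (1 - u) * G3 (x * (1 - x)) + u * G3 (y * (1 - y))"
    unfolding t_def using * by (intro convex_onD[OF convex_on_G3]) auto
  finally show "F\<^sub>3 ((1 - u) *\<^sub>R x + u *\<^sub>R y) \<le> (1 - u) * F\<^sub>3 x + u * F\<^sub>3 y"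
    using * z by (simp only: F3_eq z_def [symmetric])
qed auto

lemma rho_eq: "\<rho> = ln 16 - 4 * pi / 5"
proof -
  have "ln (16 :: real) = 4 * ln 2"
    using ln_realpow[of 2 4] by simp
  thus ?thesis by (simp add: \<rho>_def b\<^sub>0_def)
qed

lemma rho_bounds: "0.259314 \<le> \<rho>" "\<rho> < 0.259315"
  using pi_approx ln2_bounds by (simp_all add: \<rho>_def b\<^sub>0_def)

lemma F3_half: "F\<^sub>3 (1 / 2) = \<rho>"
  by (simp add: F\<^sub>3_def R_half B_half \<rho>_def b\<^sub>0_def)

lemma G3_quarter: "G3 (1 / 4) = \<rho>"
  using F3_eq[of "1 / 2"] by (simp add: F3_half)

lemma F3_less_1:
  assumes "x \<in> {0<..1/2}"
  shows "F\<^sub>3 x < 1"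
  using G3_strict_antimono[of 0 "x * (1 - x)"] times_one_minus_bounds[OF assms] assms by (simp add: F3_eq)

lemma F3_greater_rho:
  assumes "x \<in> {0<..<1/2}"
  shows "\<rho> < F\<^sub>3 x"
  using monotone_onD[OF strict_antimono_F3, of x "1 / 2"] assms by (simp add: F3_half)

text \<open>The chord of G3 over [0, 1/4] gives a bound linear in t. It is strictly better than the
  chord in x because 4 t - 2 x = 2 x (1 - 2 x) > 0.\<close>

lemma F3_less_chord:
  assumes x: "x \<in> {0<..<1/2}"
  shows "F\<^sub>3 x < \<rho> + (1 - \<rho>) * (1 - 2 * x)"
proof -
  define t where "t = x * (1 - x)"
  have t: "0 \<le> t" "t \<le> 1 / 4"
    using times_one_minus_bounds[of x] x by (auto simp: t_def)
  have "G3 ((1 - 4 * t) *\<^sub>R 0 + (4 * t) *\<^sub>R (1 / 4)) \<le> (1 - 4 * t) * G3 0 + 4 * t * G3 (1 / 4)"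
    using t by (intro convex_onD[OF convex_on_G3]) auto
  hence "G3 t \<le> 1 - (1 - \<rho>) * (4 * t)"
    by (simp add: G3_quarter algebra_simps)
  also have "\<dots> < 1 - (1 - \<rho>) * (2 * x)"
  proof -
    have "x * (1 - 2 * x) > 0" using x by (intro mult_pos_pos) auto
    hence "4 * t > 2 * x" by (simp add: t_def algebra_simps)
    thus ?thesis using rho_bounds by simp
  qed
  also have "G3 t = F\<^sub>3 x"
    using x by (simp add: F3_eq t_def)
  finally show ?thesis
    by (simp add: algebra_simps)
qed

lemma continuous_on_F3: "continuous_on {0<..1/2} F\<^sub>3"
proof -
  have "continuous_on {0<..} G3"
    by (intro convex_on_continuous convex_on_subset[OF convex_on_G3]) auto
  hence "continuous_on {0<..1/2} (\<lambda>x. G3 (x * (1 - x)))"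
    by (rule continuous_on_compose2) (auto intro!: continuous_intros simp: times_one_minus_bounds)
  thus ?thesis
    by (rule continuous_on_eq) (simp add: F3_eq)
qed

lemma image_F3: "F\<^sub>3 ` {0<..1/2} = {\<rho>..<1}"
proof
  show "F\<^sub>3 ` {0<..1/2} \<subseteq> {\<rho>..<1}"
  proof
    fix y assume "y \<in> F\<^sub>3 ` {0<..1/2}"
    then obtain x where "x \<in> {0<..1/2}" "y = F\<^sub>3 x" by auto
    thus "y \<in> {\<rho>..<1}"
      using F3_less_1[of x] F3_greater_rho[of x] F3_half by (cases "x = 1/2") auto
  qed
  show "{\<rho>..<1} \<subseteq> F\<^sub>3 ` {0<..1/2}"
  proof
    fix y assume y: "y \<in> {\<rho>..<1}"
    \<comment> \<open>The limit 1 at 0 supplies a point with value above y; the intermediate value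
      theorem on [a, 1/2] does the rest.\<close>
    have "\<forall>\<^sub>F x in at_right 0. F\<^sub>3 x > y \<and> x \<in> {0<..<1/2}"
      using y by (intro eventually_conj order_tendstoD(1)[OF tendsto_F3] eventually_at_right_real) auto
    then obtain a where a: "F\<^sub>3 a > y" "a \<in> {0<..<1/2}"
      using eventually_happens'[of "at_right (0::real)"] by auto
    have "continuous_on {a..1/2} F\<^sub>3"
      by (rule continuous_on_subset[OF continuous_on_F3]) (use a in auto)
    then obtain x where "a \<le> x" "x \<le> 1/2" "F\<^sub>3 x = y"
      using IVT2'[of F\<^sub>3 "1/2" y a] a y F3_half by auto
    thus "y \<in> F\<^sub>3 ` {0<..1/2}" using a by force
  qed
qed

section \<open>From the three functions to bounds for R\<close>

lemma R_eq_F3: "R x = F\<^sub>3 x + B x / (1 + x * (1 - x))"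
  by (simp add: F\<^sub>3_def)

lemma R_eq_F1:
  assumes "x \<in> {0<..1/2}"
  shows "R x = F\<^sub>1 x * B x / (1 + x * (1 - x))" and "B x / (1 + x * (1 - x)) > 0"
proof -
  have "B x > 0"
    using assms by (auto simp: B_def intro!: mult_pos_pos Gamma_real_pos)
  moreover have "1 + x * (1 - x) > 0"
    using times_one_minus_bounds[OF assms] by simp
  ultimately show "R x = F\<^sub>1 x * B x / (1 + x * (1 - x))" and "B x / (1 + x * (1 - x)) > 0"
    by (simp_all add: F\<^sub>1_def)
qed

text \<open>In t, strict concavity keeps G1 above the chord from G1 0 = 1 to G1 (1/4) > 1.\<close>

lemma F1_greater_1:
  assumes "x \<in> {0<..1/2}"
  shows "F\<^sub>1 x > 1"
proof (cases "x = 1 / 2")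
  case False
  define t where "t = x * (1 - x)"
  have t: "0 < t" "t < 1 / 4"
    using times_one_minus_bounds[of x] times_one_minus_less[of x "1/2"] assms False by (auto simp: t_def)
  have "(1 / 4 - t) * G1 0 + (t - 0) * G1 (1 / 4) < (1 / 4 - 0) * G1 t"
    using t by (intro strict_concave_onD[OF strict_concave_on_G1]) auto
  moreover have "t * 1 < t * G1 (1 / 4)"
    using t F1_half_bounds by (simp add: G1_at)
  ultimately have "G1 t > 1" by (simp add: G1_at)
  thus ?thesis using assms by (simp add: F1_eq t_def)
next
  case True
  show ?thesis
    unfolding True using F1_half_bounds by simp
qed

lemma F1_at_peak:
  assumes "x1 \<in> {1/4<..<1/2}" "strict_mono_on {0<..x1} F\<^sub>1" "strict_antimono_on {x1..1/2} F\<^sub>1"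
  shows "\<And>x. x \<in> {0<..1/2} \<Longrightarrow> F\<^sub>1 x \<le> F\<^sub>1 x1" "F\<^sub>1 (1 / 4) < F\<^sub>1 x1" "F\<^sub>1 x1 < 1.112146"
proof -
  show "F\<^sub>1 x \<le> F\<^sub>1 x1" if "x \<in> {0<..1/2}" for x
    using monotone_onD[OF assms(2), of x x1] monotone_onD[OF assms(3), of x1 x] assms(1) that
    by (cases x x1 rule: linorder_cases) auto
  show "F\<^sub>1 (1 / 4) < F\<^sub>1 x1"
    using monotone_onD[OF assms(2), of "1 / 4" x1] assms(1) by simp
  show "F\<^sub>1 x1 < 1.112146"
    using G1_less[of "x1 * (1 - x1)"] times_one_minus_less[of "1/4" x1] times_one_minus_less[of x1 "1/2"]
      assms(1) by (simp add: F1_eq)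
qed

theorem theorem1p3:
  shows
    "( (\<exists>!x1. x1 \<in> {1/4<..<1/2} \<and> strict_mono_on {0<..x1} F\<^sub>1 \<and> strict_antimono_on {x1..1/2} F\<^sub>1)
      \<and> (F\<^sub>1 \<longlongrightarrow> 1) (at_right 0)
      \<and> F\<^sub>1 (1/2) = 5 * ln 2 / pi
      \<and> 1.103178 \<le> F\<^sub>1 (1/2) \<and> F\<^sub>1 (1/2) < 1.103179
      \<and> \<not> convex_on {0<..1/2} F\<^sub>1 \<and> \<not> concave_on {0<..1/2} F\<^sub>1
      \<and> (\<forall>x1. x1 \<in> {1/4<..<1/2} \<and> strict_mono_on {0<..x1} F\<^sub>1 \<and> strict_antimono_on {x1..1/2} F\<^sub>1
           \<longrightarrow>
           (let \<alpha> = 1; \<delta> = F\<^sub>1 x1 in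
              (\<forall>x\<in>{0<..1/2}. \<alpha> * B x / (1 + x * (1 - x)) < R x
                            \<and> R x \<le> \<delta> * B x / (1 + x * (1 - x)))
              \<and> (\<forall>a>\<alpha>. \<exists>x\<in>{0<..1/2}. \<not> a * B x / (1 + x * (1 - x)) < R x)
              \<and> (\<forall>d<\<delta>. \<exists>x\<in>{0<..1/2}. \<not> R x \<le> d * B x / (1 + x * (1 - x)))
              \<and> 1.111592 \<le> 19 * sqrt 2 * ln 8 / (16 * pi)
              \<and> 19 * sqrt 2 * ln 8 / (16 * pi) < 1.111593
              \<and> 19 * sqrt 2 * ln 8 / (16 * pi) < \<delta>
              \<and> \<delta> < 1.112146)))
    \<and>
     ( (\<exists>!x2. x2 \<in> {0<..<1/2} \<and> strict_mono_on {0<..x2} F\<^sub>2 \<and> strict_antimono_on {x2..1/2} F\<^sub>2)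
      \<and> (F\<^sub>2 \<longlongrightarrow> 0) (at_right 0)
      \<and> F\<^sub>2 (1/2) = 4 * b\<^sub>0 / (5 * pi)
      \<and> 0.082542 \<le> F\<^sub>2 (1/2) \<and> F\<^sub>2 (1/2) < 0.082543
      \<and> \<not> convex_on {0<..1/2} F\<^sub>2 \<and> \<not> concave_on {0<..1/2} F\<^sub>2)
    \<and>
     ( strict_antimono_on {0<..1/2} F\<^sub>3
      \<and> convex_on {0<..1/2} F\<^sub>3
      \<and> F\<^sub>3 ` {0<..1/2} = {\<rho>..<1}
      \<and> \<rho> = ln 16 - 4 * pi / 5
      \<and> 0.259314 \<le> \<rho> \<and> \<rho> < 0.259315
      \<and> (\<forall>x\<in>{0<..1/2}.
           \<rho> + B x / (1 + x * (1 - x)) \<le> R x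
           \<and> R x \<le> \<rho> + (1 - \<rho>) * (1 - 2 * x) + B x / (1 + x * (1 - x))
           \<and> (\<rho> + B x / (1 + x * (1 - x)) = R x \<longleftrightarrow> x = 1/2)
           \<and> (R x = \<rho> + (1 - \<rho>) * (1 - 2 * x) + B x / (1 + x * (1 - x)) \<longleftrightarrow> x = 1/2)))"
proof (intro conjI)
  obtain x where x: "x \<in> {1/4<..<1/2}" "strict_mono_on {0<..x} F\<^sub>1" "strict_antimono_on {x..1/2} F\<^sub>1"
    by (rule F1_unimodal)
  show "\<exists>!x1. x1 \<in> {1/4<..<1/2} \<and> strict_mono_on {0<..x1} F\<^sub>1 \<and> strict_antimono_on {x1..1/2} F\<^sub>1"
  proof (rule ex1I[of _ x])
    fix y assume y: "y \<in> {1/4<..<1/2} \<and> strict_mono_on {0<..y} F\<^sub>1 \<and> strict_antimono_on {y..1/2} F\<^sub>1"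
    thus "y = x"
      using x by (intro unimodal_peak_unique[of y 0 "1/2" F\<^sub>1 x]) auto
  qed (use x in simp)
  show "\<not> convex_on {0<..1/2} F\<^sub>1"
    using x by (intro unimodal_not_convex[of x]) auto
  show "\<not> concave_on {0<..1/2} F\<^sub>1"
    using F1_quarter_bounds F1_half_bounds
    by (intro strict_concave_comp_not_concave[of F\<^sub>1 G1 "3/16"] F1_eq strict_concave_on_G1)
      (auto simp: G1_at)
  obtain x where x: "x \<in> {0<..<1/2}" "strict_mono_on {0<..x} F\<^sub>2" "strict_antimono_on {x..1/2} F\<^sub>2"
    by (rule F2_unimodal)
  show "\<exists>!x2. x2 \<in> {0<..<1/2} \<and> strict_mono_on {0<..x2} F\<^sub>2 \<and> strict_antimono_on {x2..1/2} F\<^sub>2"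
  proof (rule ex1I[of _ x])
    fix y assume y: "y \<in> {0<..<1/2} \<and> strict_mono_on {0<..y} F\<^sub>2 \<and> strict_antimono_on {y..1/2} F\<^sub>2"
    thus "y = x"
      using x by (intro unimodal_peak_unique[of y 0 "1/2" F\<^sub>2 x]) auto
  qed (use x in simp)
  show "\<not> convex_on {0<..1/2} F\<^sub>2"
    using x by (intro unimodal_not_convex[of x]) auto
  show "\<not> concave_on {0<..1/2} F\<^sub>2"
    using F2_quarter_gt F2_half_bounds
    by (intro strict_concave_comp_not_concave[of F\<^sub>2 G2 "3/16"] F2_eq strict_concave_on_G2)
      (auto simp: G2_at)
  show "\<forall>x1. x1 \<in> {1/4<..<1/2} \<and> strict_mono_on {0<..x1} F\<^sub>1 \<and> strict_antimono_on {x1..1/2} F\<^sub>1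
           \<longrightarrow>
           (let \<alpha> = 1; \<delta> = F\<^sub>1 x1 in
              (\<forall>x\<in>{0<..1/2}. \<alpha> * B x / (1 + x * (1 - x)) < R x
                            \<and> R x \<le> \<delta> * B x / (1 + x * (1 - x)))
              \<and> (\<forall>a>\<alpha>. \<exists>x\<in>{0<..1/2}. \<not> a * B x / (1 + x * (1 - x)) < R x)
              \<and> (\<forall>d<\<delta>. \<exists>x\<in>{0<..1/2}. \<not> R x \<le> d * B x / (1 + x * (1 - x)))
              \<and> 1.111592 \<le> 19 * sqrt 2 * ln 8 / (16 * pi)
              \<and> 19 * sqrt 2 * ln 8 / (16 * pi) < 1.111593
              \<and> 19 * sqrt 2 * ln 8 / (16 * pi) < \<delta>
              \<and> \<delta> < 1.112146)"
    \<comment> \<open>The constant in the lower bound for \<delta> is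
      \<open>F\<^sub>1 (1 / 4)\<close>, which lies below the peak value because the peak is to the
      right of 1/4.\<close>
    unfolding Let_def F1_quarter [symmetric]
  proof (intro allI impI conjI ballI)
    fix x1 assume "x1 \<in> {1/4<..<1/2} \<and> strict_mono_on {0<..x1} F\<^sub>1 \<and> strict_antimono_on {x1..1/2} F\<^sub>1"
    hence x1: "x1 \<in> {0<..1/2}" and peak: "\<And>x. x \<in> {0<..1/2} \<Longrightarrow> F\<^sub>1 x \<le> F\<^sub>1 x1"
      and bounds: "F\<^sub>1 (1 / 4) < F\<^sub>1 x1" "F\<^sub>1 x1 < 1.112146"
      using F1_at_peak[of x1] by auto
    show "F\<^sub>1 (1 / 4) < F\<^sub>1 x1" "F\<^sub>1 x1 < 1.112146"
      by (fact bounds)+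
    \<comment> \<open>Dividing by the positive B x / (1 + x (1 - x)) turns each bound for R into a
      comparison of its coefficient with \<open>F\<^sub>1 x\<close>. Thus \<alpha> is optimal by the
      limit 1 at 0, and \<delta> because it is attained at x1.\<close>
    have less_iff: "a * B x / (1 + x * (1 - x)) < R x \<longleftrightarrow> a < F\<^sub>1 x" if "x \<in> {0<..1/2}" for a x
      using mult_less_cancel_right_pos[OF R_eq_F1(2)[OF that], of a "F\<^sub>1 x"] R_eq_F1(1)[OF that] by simp
    have le_iff: "R x \<le> d * B x / (1 + x * (1 - x)) \<longleftrightarrow> F\<^sub>1 x \<le> d" if "x \<in> {0<..1/2}" for d x
      using less_iff[OF that, of d] R_eq_F1[OF that] mult_le_cancel_right_pos[OF R_eq_F1(2)[OF that], of "F\<^sub>1 x" d] by simp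
    show "1 * B x / (1 + x * (1 - x)) < R x" if "x \<in> {0<..1/2}" for x
      using less_iff[OF that] F1_greater_1[OF that] by blast
    show "R x \<le> F\<^sub>1 x1 * B x / (1 + x * (1 - x))" if "x \<in> {0<..1/2}" for x
      using le_iff[OF that] peak[OF that] by blast
    show "\<exists>x\<in>{0<..1/2}. \<not> a * B x / (1 + x * (1 - x)) < R x" if "a > 1" for a
    proof -
      have "\<forall>\<^sub>F x in at_right 0. F\<^sub>1 x < a \<and> x \<in> {0<..<1/2}"
        using that by (intro eventually_conj order_tendstoD(2)[OF tendsto_F1] eventually_at_right_real) auto
      then obtain x where "F\<^sub>1 x < a" "x \<in> {0<..<1/2}"
        using eventually_happens'[of "at_right (0::real)"] by auto
      thus ?thesis
        by (intro bexI[of _ x]) (auto simp: less_iff)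
    qed
    show "\<exists>x\<in>{0<..1/2}. \<not> R x \<le> d * B x / (1 + x * (1 - x))" if "d < F\<^sub>1 x1" for d
      using that x1 by (intro bexI[of _ x1]) (auto simp: le_iff)
  qed (use F1_quarter_bounds in auto)
  show "\<forall>x\<in>{0<..1/2}.
           \<rho> + B x / (1 + x * (1 - x)) \<le> R x
           \<and> R x \<le> \<rho> + (1 - \<rho>) * (1 - 2 * x) + B x / (1 + x * (1 - x))
           \<and> (\<rho> + B x / (1 + x * (1 - x)) = R x \<longleftrightarrow> x = 1/2)
           \<and> (R x = \<rho> + (1 - \<rho>) * (1 - 2 * x) + B x / (1 + x * (1 - x)) \<longleftrightarrow> x = 1/2)"
  proof
    fix x :: real assume x: "x \<in> {0<..1/2}"
    show "\<rho> + B x / (1 + x * (1 - x)) \<le> R x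
           \<and> R x \<le> \<rho> + (1 - \<rho>) * (1 - 2 * x) + B x / (1 + x * (1 - x))
           \<and> (\<rho> + B x / (1 + x * (1 - x)) = R x \<longleftrightarrow> x = 1/2)
           \<and> (R x = \<rho> + (1 - \<rho>) * (1 - 2 * x) + B x / (1 + x * (1 - x)) \<longleftrightarrow> x = 1/2)"
    proof (cases "x = 1/2")
      case True
      show ?thesis
        unfolding R_eq_F3 True by (simp add: F3_half)
    next
      case False
      thus ?thesis
        unfolding R_eq_F3 using F3_greater_rho[of x] F3_less_chord[of x] x by auto
    qed
  qed
qed (fact tendsto_F1 tendsto_F2 F1_half F1_half_bounds F2_half F2_half_bounds strict_antimono_F3
    convex_on_F3 image_F3 rho_eq rho_bounds)+

end
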